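(* Let $1<p<\infty$, let $T=(V,E)$ be a leafless, locally finite rooted directed tree with root $o$, and let $B_\lambda$ be a weighted backward shift that is a bounded linear operator on $\operatorname{Ces}_p(T)$ and has nonzero weights (that is, $\lambda_u\in\mathbb C\setminus\{0\}$ for every $u\in V\setminus\{o\}$). Then the following assertions are equivalent: (i) $B_\lambda$ is chaotic; (ii) the periodic points of $B_\lambda$ are dense in $\operatorname{Ces}_p(T)$; (iii) for every $v\in V$, there exists $f_v\in\operatorname{Ces}_p(T)$, supported on $V(v)$, such that $$f_v(v)=1,\qquad B_\lambda f_v=f_v\ \text{ on } V(v);$$ (iv) for every $v\in V$, there exists a unit flow $\theta:V(v)\to[0,\infty)$ such that $$\sum_{N=|v|}^\infty\biggl(\frac1{N+1}\sum_{s=|v|}^N\frac1{c_s}\sum_{u\in\operatorname{Chi}^{s-|v|}(v)}\frac{\theta(u)}{|\lambda(v\to u)|}\biggr)^p<\infty.$$ Moreover, each of these conditions implies that $B_\lambda$ is topologically mixing.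
   Context: Trees. A directed tree $T=(V,E)$ has a countably infinite vertex set $V$ and edge set $E\subseteq V\times V$ such that the underlying undirected graph is connected and has no cycles, and every vertex has at most one parent (a parent of $v$ is a vertex $w$ with $(w,v)\in E$). It is rooted if it has a unique vertex $o$ (the root) without a parent. The set of children of $v$ is $\operatorname{Chi}(v)=\{u\in V:(v,u)\in E\}$; $\operatorname{Chi}^0(v)=\{v\}$, $\operatorname{Chi}^{n+1}(v)=\bigcup_{u\in\operatorname{Chi}^n(v)}\operatorname{Chi}(u)$, and $V(v)=\bigcup_{n\ge0}\operatorname{Chi}^n(v)$ is the descendant subtree of $v$. The tree is locally finite if every $\operatorname{Chi}(v)$ is finite, and leafless if every $\operatorname{Chi}(v)$ is nonempty. For $v\in V$, $|v|$ is the length of the unique path from $o$ to $v$; $D_n=\{v\in V:|v|=n\}$ and $c_n=|D_n|$ (cardinality) for $n\in\mathbb N_0$. Ces\`aro space. For $f:V\to\mathbb C$ put $A_n(f)=\frac1{c_n}\sum_{v\in D_n}|f(v)|$. For $1<p<\infty$, $\operatorname{Ces}_p(T)$ is the space of all $f:V\to\mathbb C$ with $$\|f\|_{\operatorname{Ces}_p(T)}=\Biggl[\sum_{n=0}^\infty\biggl(\frac1{n+1}\sum_{r=0}^nA_r(f)\biggr)^p\Biggr]^{1/p}<\infty;$$ it is a separable Banach space with this norm. Weighted backward shift. For a family $\lambda=(\lambda_u)_{u\in V\setminus\{o\}}$ of complex weights, $B_\lambda f(v)=\sum_{u\in\operatorname{Chi}(v)}\lambda_uf(u)$, $v\in V$.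 If $u\in\operatorname{Chi}^n(v)$ and $v=v_0,v_1,\dots,v_n=u$ is the unique path from $v$ to $u$, then $\lambda(v\to u)=\prod_{j=1}^n\lambda_{v_j}$ (so $\lambda(v\to v)=1$). Flows. For $v\in V$, a function $\theta:V(v)\to[0,\infty)$ is a flow on $V(v)$ if $\theta(u)=\sum_{w\in\operatorname{Chi}(u)}\theta(w)$ for every $u\in V(v)$; it is a unit flow if moreover $\theta(v)=1$. Dynamics. Let $S$ be a bounded linear operator on a separable Banach space $X$. $S$ is hypercyclic if there is $x\in X$ with $\{S^nx:n\in\mathbb N_0\}$ dense in $X$. A vector $x$ is periodic for $S$ if $S^nx=x$ for some integer $n\ge1$. $S$ is chaotic if it is hypercyclic and its periodic points are dense in $X$. $S$ is topologically mixing if for all nonempty open $U,W\subseteq X$ there is $n_0\in\mathbb N_0$ such that $S^n(U)\cap W\ne\varnothing$ for all $n\ge n_0$. *)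

theory Defs
  imports "HOL-Analysis.Analysis"
begin

section \<open>Directed trees\<close>

text \<open>
  The vertex set of a tree is the whole type \<^typ>\<open>'v\<close>; the tree is given by its edge set,
  with \<open>(v, u) \<in> E\<close> meaning that \<open>v\<close> is the parent of \<open>u\<close>.
\<close>

text \<open>
  A cycle of the underlying undirected graph is listed without repeating its first vertex.
  Length 1 is a loop; length 2 is excluded because it runs back and forth along one undirected
  edge.
\<close>

definition undirected_cycle :: "('v \<times> 'v) set \<Rightarrow> 'v list \<Rightarrow> bool" where
  "undirected_cycle E xs \<longleftrightarrow>
     xs \<noteq> [] \<and> length xs \<noteq> 2 \<and> distinct xs \<and>
     successively (\<lambda>a b. (a, b) \<in> E \<union> E\<inverse>) xs \<and> (last xs, hd xs) \<in> E \<union> E\<inverse>"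

definition directed_tree :: "('v \<times> 'v) set \<Rightarrow> bool" where
  "directed_tree E \<longleftrightarrow>
     countable (UNIV :: 'v set) \<and> infinite (UNIV :: 'v set) \<and>
     (\<forall>u v. (u, v) \<in> (E \<union> E\<inverse>)\<^sup>*) \<and>
     (\<nexists>xs. undirected_cycle E xs) \<and>
     (\<forall>v w w'. (w, v) \<in> E \<longrightarrow> (w', v) \<in> E \<longrightarrow> w = w')"

definition rooted_directed_tree :: "('v \<times> 'v) set \<Rightarrow> 'v \<Rightarrow> bool" where
  "rooted_directed_tree E rt \<longleftrightarrow>
     directed_tree E \<and> (\<forall>v. (\<nexists>w. (w, v) \<in> E) \<longleftrightarrow> v = rt)"

definition Chi :: "('v \<times> 'v) set \<Rightarrow> 'v \<Rightarrow> 'v set" where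
  "Chi E v = {u. (v, u) \<in> E}"

primrec Chi_pow :: "('v \<times> 'v) set \<Rightarrow> nat \<Rightarrow> 'v \<Rightarrow> 'v set" where
  "Chi_pow E 0 v = {v}"
| "Chi_pow E (Suc n) v = (\<Union>u\<in>Chi_pow E n v. Chi E u)"

definition descendants :: "('v \<times> 'v) set \<Rightarrow> 'v \<Rightarrow> 'v set" where
  "descendants E v = (\<Union>n. Chi_pow E n v)"

definition locally_finite_tree :: "('v \<times> 'v) set \<Rightarrow> bool" where
  "locally_finite_tree E \<longleftrightarrow> (\<forall>v. finite (Chi E v))"

definition leafless :: "('v \<times> 'v) set \<Rightarrow> bool" where
  "leafless E \<longleftrightarrow> (\<forall>v. Chi E v \<noteq> {})"

text \<open>
  The unique path, as the list of its vertices; meaningful if \<open>u\<close> is a descendant of \<open>v\<close>.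
\<close>

definition tree_path :: "('v \<times> 'v) set \<Rightarrow> 'v \<Rightarrow> 'v \<Rightarrow> 'v list" where
  "tree_path E v u =
     (THE xs. xs \<noteq> [] \<and> hd xs = v \<and> last xs = u \<and> distinct xs \<and>
              successively (\<lambda>a b. (a, b) \<in> E) xs)"

definition depth :: "('v \<times> 'v) set \<Rightarrow> 'v \<Rightarrow> 'v \<Rightarrow> nat" where
  "depth E rt v = length (tree_path E rt v) - 1"

definition level :: "('v \<times> 'v) set \<Rightarrow> 'v \<Rightarrow> nat \<Rightarrow> 'v set" where
  "level E rt n = {v. depth E rt v = n}"

definition level_card :: "('v \<times> 'v) set \<Rightarrow> 'v \<Rightarrow> nat \<Rightarrow> nat" where
  "level_card E rt n = card (level E rt n)"


section \<open>The Cesaro space of a tree\<close>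

definition level_avg :: "('v \<times> 'v) set \<Rightarrow> 'v \<Rightarrow> nat \<Rightarrow> ('v \<Rightarrow> complex) \<Rightarrow> real" where
  "level_avg E rt n f = 1 / real (level_card E rt n) * (\<Sum>v\<in>level E rt n. cmod (f v))"

definition ces_term ::
    "('v \<times> 'v) set \<Rightarrow> 'v \<Rightarrow> real \<Rightarrow> ('v \<Rightarrow> complex) \<Rightarrow> nat \<Rightarrow> real" where
  "ces_term E rt p f n = (1 / (real n + 1) * (\<Sum>r=0..n. level_avg E rt r f)) powr p"

definition Ces :: "('v \<times> 'v) set \<Rightarrow> 'v \<Rightarrow> real \<Rightarrow> ('v \<Rightarrow> complex) set" where
  "Ces E rt p = {f. summable (ces_term E rt p f)}"

definition ces_norm :: "('v \<times> 'v) set \<Rightarrow> 'v \<Rightarrow> real \<Rightarrow> ('v \<Rightarrow> complex) \<Rightarrow> real" where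
  "ces_norm E rt p f = (\<Sum>n. ces_term E rt p f n) powr (1 / p)"

text \<open>
  For \<open>1 < p\<close> and a leafless, locally finite rooted tree, all levels are finite and nonempty and
  \<open>ces_norm\<close> is a norm on \<open>Ces\<close>, so that the metric below satisfies the assumptions of
  \<^locale>\<open>Metric_space\<close>. Outside \<open>Ces\<close> the value of \<open>ces_norm\<close> has no meaning.
\<close>

definition ces_topology ::
    "('v \<times> 'v) set \<Rightarrow> 'v \<Rightarrow> real \<Rightarrow> ('v \<Rightarrow> complex) topology" where
  "ces_topology E rt p =
     Metric_space.mtopology (Ces E rt p) (\<lambda>f g. ces_norm E rt p (\<lambda>v. f v - g v))"

definition bounded_operator_Ces ::
    "('v \<times> 'v) set \<Rightarrow> 'v \<Rightarrow> real \<Rightarrow> (('v \<Rightarrow> complex) \<Rightarrow> ('v \<Rightarrow> complex)) \<Rightarrow> bool" where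
  "bounded_operator_Ces E rt p S \<longleftrightarrow>
     (\<forall>f\<in>Ces E rt p. S f \<in> Ces E rt p) \<and>
     (\<forall>f\<in>Ces E rt p. \<forall>g\<in>Ces E rt p. S (\<lambda>v. f v + g v) = (\<lambda>v. S f v + S g v)) \<and>
     (\<forall>c. \<forall>f\<in>Ces E rt p. S (\<lambda>v. c * f v) = (\<lambda>v. c * S f v)) \<and>
     (\<exists>C. \<forall>f\<in>Ces E rt p. ces_norm E rt p (S f) \<le> C * ces_norm E rt p f)"


section \<open>Weighted backward shifts and flows\<close>

text \<open>
  A weight family is a function on all vertices; its value at the root is never used, since the
  root is nobody's child.
\<close>

definition backward_shift ::
    "('v \<times> 'v) set \<Rightarrow> ('v \<Rightarrow> complex) \<Rightarrow> ('v \<Rightarrow> complex) \<Rightarrow> 'v \<Rightarrow> complex" where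
  "backward_shift E lam f v = (\<Sum>u\<in>Chi E v. lam u * f u)"

definition path_weight ::
    "('v \<times> 'v) set \<Rightarrow> ('v \<Rightarrow> complex) \<Rightarrow> 'v \<Rightarrow> 'v \<Rightarrow> complex" where
  "path_weight E lam v u = prod_list (map lam (tl (tree_path E v u)))"

text \<open>
  A flow on the descendant subtree of \<open>v\<close> is represented by a function on all vertices, whose
  values outside that subtree play no role.
\<close>

definition flow_on :: "('v \<times> 'v) set \<Rightarrow> 'v \<Rightarrow> ('v \<Rightarrow> real) \<Rightarrow> bool" where
  "flow_on E v \<theta> \<longleftrightarrow>
     (\<forall>u\<in>descendants E v. 0 \<le> \<theta> u \<and> \<theta> u = (\<Sum>w\<in>Chi E u. \<theta> w))"

definition unit_flow_on :: "('v \<times> 'v) set \<Rightarrow> 'v \<Rightarrow> ('v \<Rightarrow> real) \<Rightarrow> bool" where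
  "unit_flow_on E v \<theta> \<longleftrightarrow> flow_on E v \<theta> \<and> \<theta> v = 1"


section \<open>Dynamics of a self-map of a topological space\<close>

definition dense_in :: "'a topology \<Rightarrow> 'a set \<Rightarrow> bool" where
  "dense_in X A \<longleftrightarrow> A \<subseteq> topspace X \<and> X closure_of A = topspace X"

definition hypercyclic :: "'a topology \<Rightarrow> ('a \<Rightarrow> 'a) \<Rightarrow> bool" where
  "hypercyclic X S \<longleftrightarrow> (\<exists>x\<in>topspace X. dense_in X {(S ^^ n) x | n. True})"

definition periodic_points :: "'a topology \<Rightarrow> ('a \<Rightarrow> 'a) \<Rightarrow> 'a set" where
  "periodic_points X S = {x \<in> topspace X. \<exists>n\<ge>1. (S ^^ n) x = x}"

definition chaotic :: "'a topology \<Rightarrow> ('a \<Rightarrow> 'a) \<Rightarrow> bool" where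
  "chaotic X S \<longleftrightarrow> hypercyclic X S \<and> dense_in X (periodic_points X S)"

definition topologically_mixing :: "'a topology \<Rightarrow> ('a \<Rightarrow> 'a) \<Rightarrow> bool" where
  "topologically_mixing X S \<longleftrightarrow>
     (\<forall>U W. openin X U \<longrightarrow> U \<noteq> {} \<longrightarrow> openin X W \<longrightarrow> W \<noteq> {} \<longrightarrow>
        (\<exists>n0. \<forall>n\<ge>n0. (S ^^ n) ` U \<inter> W \<noteq> {}))"

end

theory Submission
  imports Defs
begin

text \<open>
  Write \<open>|v|\<close> for the depth of \<open>v\<close>, \<open>V(v)\<close> for the descendants of \<open>v\<close> and \<open>\<lambda>(v \<rightarrow> u)\<close> for the
  path weight. Everything is reduced to fixed vectors: elements \<open>f\<close> of the space that are supported
  on \<open>V(v)\<close>, take the value 1 at \<open>v\<close> and satisfy \<open>B f = f\<close> on \<open>V(v)\<close>.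

  Fixed vectors and flows. The series in the flow condition is the \<open>p\<close>-th power of the norm of
  \<open>u \<mapsto> \<theta>(u) / \<lambda>(v \<rightarrow> u)\<close> on \<open>V(v)\<close>, and the flow equation for \<open>\<theta>\<close> says precisely that this
  vector is fixed (\<open>flow_summable_iff\<close>, \<open>fixed_vector_flow_vector\<close>). Conversely, let \<open>H \<ge> 0\<close> be a
  function in the space with \<open>H(v) > 0\<close> and, for each \<open>u\<close> in \<open>V(v)\<close>, \<open>H(u) \<le> \<Sum> |\<lambda>\<^sub>w| H(w)\<close>,
  summed over the children \<open>w\<close> of \<open>u\<close>. Then a unit mass at \<open>v\<close> can be sent down the tree without ever exceeding the capacity
  \<open>|\<lambda>(v \<rightarrow> u)| H(u) / H(v)\<close>, which gives a flow with convergent series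
  (\<open>superflow_contains_unit_flow\<close>). Such an \<open>H\<close> is \<open>|f|\<close> for a fixed vector \<open>f\<close>. It is also
  \<open>\<Sum>\<^sub>j |B\<^sup>j g|\<close>, over one period, for a periodic point \<open>g\<close> with \<open>g(v) \<noteq> 0\<close>, and such a \<open>g\<close>
  exists for each \<open>v\<close> if the periodic points are dense (\<open>periodic_imp_summable_flow\<close>).

  Dynamics. Because \<open>B\<close> lowers the depth by one, the part of a fixed vector on the level
  \<open>|v| + n\<close> is an \<open>n\<close>-th preimage of the unit vector at \<open>v\<close>. It is a piece of the tail of a vector
  in the space, so that it tends to 0 as \<open>n \<rightarrow> \<infinity>\<close>. As each vector with finitely many nonzero values
  is annihilated by a power of \<open>B\<close> and these vectors are dense, \<open>B\<close> is mixing
  (\<open>fixed_vectors_imp_mixing\<close>). The sum of the parts on the levels \<open>|v| + kN\<close> over all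
  \<open>k \<ge> 0\<close> is an \<open>N\<close>-periodic point close to the unit vector at \<open>v\<close> if \<open>N\<close> is large, so that the
  periodic points are dense (\<open>periodic_points_dense\<close>).

  Finally, mixing implies hypercyclicity by Birkhoff's transitivity theorem, which needs that the
  Cesaro space is complete and separable (\<open>Ces_mcomplete\<close>, \<open>Ces_separable\<close>).
\<close>

section \<open>Minkowski's inequality for series\<close>

lemma powr_convex_combination:
  fixes a b s t p :: real
  assumes "1 \<le> p" "0 \<le> a" "0 \<le> b" "0 \<le> s" "0 \<le> t" "s + t = 1"
  shows "(s * a + t * b) powr p \<le> s * a powr p + t * b powr p"
proof -
  have scale: "(r * x) powr p \<le> r * x powr p" if "0 \<le> r" "r \<le> 1" "0 \<le> x" for r x :: real
  proof (cases "r = 0")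
    case False
    then have "r powr p \<le> r powr 1"
      using that assms(1) by (intro powr_mono') auto
    then show ?thesis
      using that False by (simp add: powr_mult mult_right_mono)
  qed simp
  show ?thesis
  proof (cases "a = 0 \<or> b = 0")
    case True
    then show ?thesis
      using scale[of s a] scale[of t b] assms by auto
  next
    case False
    have s: "s = 1 - t" using assms by simp
    show ?thesis
      using convex_onD[OF powr_convex[OF \<open>1 \<le> p\<close>], of t a b] False assms
      unfolding s by simp
  qed
qed

text \<open>
  The unit ball of \<open>\<ell>\<^sup>p\<close> is convex because \<open>x \<mapsto> x\<^sup>p\<close> is, and a homogeneous functional with
  convex unit ball is subadditive: \<open>(a + b) / (\<alpha> + \<beta>)\<close> is a convex combination of
  \<open>a / \<alpha>\<close> and \<open>b / \<beta>\<close>. Bounds \<open>\<alpha>\<close>, \<open>\<beta>\<close> that need not be attained leave room to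
  avoid dividing by a vanishing norm.
\<close>

lemma Minkowski_suminf_bound:
  fixes a b :: "nat \<Rightarrow> real" and p \<alpha> \<beta> :: real
  assumes p: "1 \<le> p"
    and a: "\<And>n. 0 \<le> a n" and b: "\<And>n. 0 \<le> b n"
    and sa: "summable (\<lambda>n. a n powr p)" and sb: "summable (\<lambda>n. b n powr p)"
    and \<alpha>: "0 < \<alpha>" "(\<Sum>n. a n powr p) \<le> \<alpha> powr p"
    and \<beta>: "0 < \<beta>" "(\<Sum>n. b n powr p) \<le> \<beta> powr p"
  shows "summable (\<lambda>n. (a n + b n) powr p)"
    and "(\<Sum>n. (a n + b n) powr p) \<le> (\<alpha> + \<beta>) powr p"
proof -
  define s where "s = \<alpha> / (\<alpha> + \<beta>)"
  define t where "t = \<beta> / (\<alpha> + \<beta>)"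
  have st: "0 \<le> s" "0 \<le> t" "s + t = 1"
    using \<alpha> \<beta> by (auto simp: s_def t_def add_divide_distrib[symmetric])
  define M where "M n = (\<alpha> + \<beta>) powr p * (s / \<alpha> powr p * a n powr p + t / \<beta> powr p * b n powr p)"
    for n
  have le: "(a n + b n) powr p \<le> M n" for n
  proof -
    have eq: "a n + b n = (\<alpha> + \<beta>) * (s * (a n / \<alpha>) + t * (b n / \<beta>))"
      using \<alpha> \<beta> by (simp add: s_def t_def distrib_left)
    have "(a n + b n) powr p = (\<alpha> + \<beta>) powr p * (s * (a n / \<alpha>) + t * (b n / \<beta>)) powr p"
      unfolding eq using \<alpha> \<beta> st a b by (intro powr_mult; simp)
    also have "\<dots> \<le> (\<alpha> + \<beta>) powr p * (s * (a n / \<alpha>) powr p + t * (b n / \<beta>) powr p)"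
      using \<alpha> \<beta> a b by (intro mult_left_mono powr_convex_combination p st) auto
    also have "\<dots> = M n"
      using \<alpha> \<beta> a b by (simp add: M_def powr_divide)
    finally show ?thesis .
  qed
  have sM: "summable M"
    unfolding M_def by (intro summable_mult summable_add sa sb)
  show sum: "summable (\<lambda>n. (a n + b n) powr p)"
    using le by (intro summable_comparison_test'[OF sM, of 0]) auto
  have "(\<Sum>n. (a n + b n) powr p) \<le> suminf M"
    by (intro suminf_le le sum sM)
  also have "\<dots> = (\<alpha> + \<beta>) powr p *
      (s / \<alpha> powr p * (\<Sum>n. a n powr p) + t / \<beta> powr p * (\<Sum>n. b n powr p))"
    unfolding M_def
    by (intro sums_unique[symmetric] sums_mult sums_add summable_sums sa sb)
  also have "\<dots> \<le> (\<alpha> + \<beta>) powr p *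
      (s / \<alpha> powr p * \<alpha> powr p + t / \<beta> powr p * \<beta> powr p)"
    using \<alpha> \<beta> st by (intro mult_left_mono add_mono) auto
  also have "\<dots> = (\<alpha> + \<beta>) powr p"
    using \<alpha> \<beta> st by simp
  finally show "(\<Sum>n. (a n + b n) powr p) \<le> (\<alpha> + \<beta>) powr p" .
qed

section \<open>Levels and paths of a rooted tree\<close>

locale rooted_tree =
  fixes E :: "('v \<times> 'v) set" and rt :: 'v
  assumes tree: "rooted_directed_tree E rt"
    and leafless: "leafless E"
    and locally_finite: "locally_finite_tree E"
begin

abbreviation "c \<equiv> level_card E rt"

lemma finite_Chi [simp]: "finite (Chi E v)"
  using locally_finite by (auto simp: locally_finite_tree_def)

lemma Chi_nonempty: "Chi E v \<noteq> {}"
  using leafless by (auto simp: leafless_def)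

lemma parent_unique: "u \<in> Chi E v \<Longrightarrow> u \<in> Chi E v' \<Longrightarrow> v = v'"
  using tree by (auto simp: rooted_directed_tree_def directed_tree_def Chi_def)

lemma root_not_child: "rt \<notin> Chi E v"
  using tree by (auto simp: rooted_directed_tree_def Chi_def)

lemma finite_Chi_pow [simp]: "finite (Chi_pow E n v)"
  by (induction n) auto

lemma Chi_pow_nonempty: "Chi_pow E n v \<noteq> {}"
  by (induction n) (use Chi_nonempty in auto)

text \<open>Both chains of parents lead back to the root, which has none.\<close>

lemma Chi_pow_root_unique: "u \<in> Chi_pow E n rt \<Longrightarrow> u \<in> Chi_pow E m rt \<Longrightarrow> n = m"
proof (induction n arbitrary: u m)
  case 0
  then show ?case
    by (cases m) (auto dest: root_not_child[THEN notE])
next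
  case (Suc n)
  then obtain m' where "m = Suc m'"
    by (cases m) (auto dest: root_not_child[THEN notE])
  with Suc show ?case
    by simp (metis parent_unique)
qed

lemma descendants_refl [simp]: "v \<in> descendants E v"
  by (auto simp: descendants_def intro: exI[of _ 0])

lemma descendants_Chi:
  assumes "u \<in> descendants E v" "w \<in> Chi E u"
  shows "w \<in> descendants E v"
proof -
  from assms obtain n where "u \<in> Chi_pow E n v" by (auto simp: descendants_def)
  with assms have "w \<in> Chi_pow E (Suc n) v" by auto
  then show ?thesis unfolding descendants_def by blast
qed

lemma descendants_induct [consumes 1, case_names self child]:
  assumes "u \<in> descendants E v" "P v"
    and "\<And>u w. u \<in> descendants E v \<Longrightarrow> w \<in> Chi E u \<Longrightarrow> P u \<Longrightarrow> P w"
  shows "P u"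
proof -
  have "P u" if "u \<in> Chi_pow E n v" for n
    using that
  proof (induction n arbitrary: u)
    case (Suc n)
    then obtain x where x: "x \<in> Chi_pow E n v" "u \<in> Chi E x" by auto
    then have "x \<in> descendants E v" by (auto simp: descendants_def)
    with Suc.IH x assms(3) show ?case by blast
  qed (use assms in simp)
  with assms show ?thesis by (auto simp: descendants_def)
qed

text \<open>
  The set of descendants of the root is closed under taking children, and under taking parents
  since parents are unique; hence connectedness makes it everything.
\<close>

lemma descendants_root: "u \<in> descendants E rt"
proof -
  have "(rt, u) \<in> (E \<union> E\<inverse>)\<^sup>*"
    using tree by (auto simp: rooted_directed_tree_def directed_tree_def)
  then show ?thesis
  proof (induction rule: rtrancl_induct)
    case (step y z)
    show ?case
    proof (cases "(y, z) \<in> E")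
      case True
      then show ?thesis
        using step.IH by (auto simp: Chi_def intro: descendants_Chi)
    next
      case False
      then have zy: "y \<in> Chi E z"
        using step.hyps by (auto simp: Chi_def)
      from step.IH obtain n where n: "y \<in> Chi_pow E n rt"
        by (auto simp: descendants_def)
      then obtain m where "n = Suc m"
        using zy root_not_child by (cases n) auto
      then have "z \<in> Chi_pow E m rt"
        using n zy by (auto dest: parent_unique)
      then show ?thesis
        by (auto simp: descendants_def)
    qed
  qed simp
qed

text \<open>
  The depth, obtained without paths: the uniqueness of directed paths is derived from the fact that
  the rank increases along every edge.
\<close>

definition rank :: "'v \<Rightarrow> nat" where
  "rank u = (THE n. u \<in> Chi_pow E n rt)"

lemma in_Chi_pow_root_iff: "u \<in> Chi_pow E n rt \<longleftrightarrow> rank u = n"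
proof -
  obtain m where m: "u \<in> Chi_pow E m rt"
    using descendants_root[of u] by (auto simp: descendants_def)
  then have "rank u = m"
    unfolding rank_def using Chi_pow_root_unique by blast
  with m Chi_pow_root_unique show ?thesis by blast
qed

lemma rank_Chi: "u \<in> Chi E v \<Longrightarrow> rank u = Suc (rank v)"
proof -
  assume "u \<in> Chi E v"
  moreover have "v \<in> Chi_pow E (rank v) rt"
    by (simp add: in_Chi_pow_root_iff)
  ultimately have "u \<in> Chi_pow E (Suc (rank v)) rt" by auto
  then show ?thesis by (simp only: in_Chi_pow_root_iff)
qed

definition is_path :: "'v \<Rightarrow> 'v \<Rightarrow> 'v list \<Rightarrow> bool" where
  "is_path v u xs \<longleftrightarrow> xs \<noteq> [] \<and> hd xs = v \<and> last xs = u \<and> distinct xs \<and>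
     successively (\<lambda>a b. (a, b) \<in> E) xs"

lemma is_path_rank_le: "is_path v u xs \<Longrightarrow> x \<in> set xs \<Longrightarrow> rank x \<le> rank u"
proof (induction xs arbitrary: u rule: rev_induct)
  case (snoc y ys)
  show ?case
  proof (cases "ys = []")
    case False
    with snoc.prems have "is_path v (last ys) ys" "y \<in> Chi E (last ys)" "u = y"
      by (auto simp: is_path_def successively_append_iff Chi_def)
    with snoc.IH[of "last ys"] snoc.prems show ?thesis
      by (auto dest!: rank_Chi)
  qed (use snoc in \<open>auto simp: is_path_def\<close>)
qed simp

lemma is_path_snoc:
  assumes "is_path v u xs" "w \<in> Chi E u"
  shows "is_path v w (xs @ [w])"
proof -
  have "w \<notin> set xs"
    using is_path_rank_le[OF assms(1)] rank_Chi[OF assms(2)] by fastforce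
  then show ?thesis
    using assms by (auto simp: is_path_def successively_append_iff Chi_def)
qed

text \<open>Paths are compared from the end, where each step back is forced.\<close>

lemma is_path_unique: "is_path v u xs \<Longrightarrow> is_path v u ys \<Longrightarrow> xs = ys"
proof (induction xs arbitrary: u ys rule: rev_induct)
  case (snoc x xs)
  have x: "x = u" using snoc.prems by (auto simp: is_path_def)
  obtain zs where ys: "ys = zs @ [u]"
    using snoc.prems by (metis append_butlast_last_id is_path_def)
  have single: "ws = []" if "is_path v v (ws @ [v])" for ws
    using that by (cases ws) (auto simp: is_path_def)
  show ?case
  proof (cases "u = v")
    case True
    then show ?thesis using single snoc.prems x ys by metis
  next
    case False
    then have ne: "xs \<noteq> []" "zs \<noteq> []"
      using snoc.prems x ys by (auto simp: is_path_def)
    then have xs: "is_path v (last xs) xs" "u \<in> Chi E (last xs)"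
      and zs: "is_path v (last zs) zs" "u \<in> Chi E (last zs)"
      using snoc.prems x ys by (auto simp: is_path_def successively_append_iff Chi_def)
    then have "last xs = last zs" by (auto dest: parent_unique)
    with snoc.IH[of "last xs" zs] xs zs show ?thesis
      by (simp add: x ys)
  qed
qed (simp add: is_path_def)

lemma tree_path_eqI: "is_path v u xs \<Longrightarrow> tree_path E v u = xs"
  unfolding tree_path_def is_path_def[symmetric]
  using is_path_unique by blast

lemma is_path_tree_path:
  assumes "u \<in> descendants E v"
  shows "is_path v u (tree_path E v u)"
proof -
  have "\<exists>xs. is_path v u xs" if "u \<in> Chi_pow E n v" for n
    using that
  proof (induction n arbitrary: u)
    case 0
    then have "is_path v u [v]" by (auto simp: is_path_def)
    then show ?case by blast
  next
    case (Suc n)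
    then show ?case using is_path_snoc by simp blast
  qed
  with assms obtain xs where "is_path v u xs" by (auto simp: descendants_def)
  then show ?thesis by (simp add: tree_path_eqI)
qed

lemma tree_path_self [simp]: "tree_path E v v = [v]"
  by (rule tree_path_eqI) (auto simp: is_path_def)

lemma tree_path_snoc:
  "u \<in> descendants E v \<Longrightarrow> w \<in> Chi E u \<Longrightarrow> tree_path E v w = tree_path E v u @ [w]"
  using tree_path_eqI[OF is_path_snoc[OF is_path_tree_path]] by blast

lemma tree_path_nonempty: "u \<in> descendants E v \<Longrightarrow> tree_path E v u \<noteq> []"
  using is_path_tree_path by (auto simp: is_path_def)

lemma path_weight_self [simp]: "path_weight E \<mu> v v = 1"
  by (simp add: path_weight_def)

lemma path_weight_Chi:
  "u \<in> descendants E v \<Longrightarrow> w \<in> Chi E u \<Longrightarrow> path_weight E \<mu> v w = path_weight E \<mu> v u * \<mu> w"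
  by (simp add: path_weight_def tree_path_snoc tree_path_nonempty)

lemma path_weight_nonzero:
  assumes "u \<in> descendants E v" "\<And>w. w \<noteq> rt \<Longrightarrow> \<mu> w \<noteq> 0"
  shows "path_weight E \<mu> v u \<noteq> 0"
  using assms(1)
proof (induction rule: descendants_induct)
  case (child u w)
  then have "\<mu> w \<noteq> 0" using assms(2) root_not_child by metis
  with child show ?case by (simp add: path_weight_Chi)
qed simp

lemma depth_eq_rank: "depth E rt v = rank v"
proof -
  have "length (tree_path E rt v) = Suc n" if "v \<in> Chi_pow E n rt" for n
    using that
  proof (induction n arbitrary: v)
    case (Suc n)
    then show ?case
      using tree_path_snoc[OF descendants_root] by auto
  qed simp
  then show ?thesis
    by (simp add: depth_def in_Chi_pow_root_iff)
qed

lemma level_eq_Chi_pow: "level E rt n = Chi_pow E n rt"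
  by (auto simp: level_def depth_eq_rank in_Chi_pow_root_iff)

lemma finite_level [simp]: "finite (level E rt n)"
  by (simp add: level_eq_Chi_pow)

lemma level_card_pos [simp]: "0 < c n"
  by (simp add: level_card_def card_gt_0_iff level_eq_Chi_pow Chi_pow_nonempty)

lemma in_level_iff [simp]: "v \<in> level E rt n \<longleftrightarrow> depth E rt v = n"
  by (simp add: level_def)

lemma depth_Chi: "u \<in> Chi E v \<Longrightarrow> depth E rt u = Suc (depth E rt v)"
  by (simp add: depth_eq_rank rank_Chi)

lemma depth_Chi_pow: "u \<in> Chi_pow E n v \<Longrightarrow> depth E rt u = depth E rt v + n"
  by (induction n arbitrary: u) (auto dest: depth_Chi)

lemma in_descendants_iff:
  "u \<in> descendants E v \<longleftrightarrow>
     depth E rt v \<le> depth E rt u \<and> u \<in> Chi_pow E (depth E rt u - depth E rt v) v"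
  by (auto simp: descendants_def depth_Chi_pow)

lemma finite_depth_less: "finite {v. depth E rt v < n}"
proof -
  have "{v. depth E rt v < n} = (\<Union>m<n. level E rt m)" by auto
  then show ?thesis by simp
qed

lemma descendants_parent:
  assumes "w \<in> descendants E v" "w \<in> Chi E u" "w \<noteq> v"
  shows "u \<in> descendants E v"
proof -
  from assms obtain n where n: "w \<in> Chi_pow E n v" by (auto simp: descendants_def)
  with assms obtain m where "n = Suc m" by (cases n) auto
  with n assms have "u \<in> Chi_pow E m v" by (auto dest: parent_unique)
  then show ?thesis by (auto simp: descendants_def)
qed

end

section \<open>The Cesaro space is a separable Banach space\<close>

locale cesaro_tree = rooted_tree E rt for E :: "('v \<times> 'v) set" and rt :: 'v +
  fixes p :: real
  assumes p: "1 < p"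
begin

abbreviation "\<C> \<equiv> Ces E rt p"
abbreviation "nrm \<equiv> ces_norm E rt p"

definition cesaro_mean :: "('v \<Rightarrow> complex) \<Rightarrow> nat \<Rightarrow> real" where
  "cesaro_mean f n = 1 / (real n + 1) * (\<Sum>r=0..n. level_avg E rt r f)"

lemma ces_term_eq: "ces_term E rt p f n = cesaro_mean f n powr p"
  by (simp add: ces_term_def cesaro_mean_def)

lemma ces_term_nonneg [simp]: "0 \<le> ces_term E rt p f n"
  by (simp add: ces_term_eq)

lemma level_avg_nonneg: "0 \<le> level_avg E rt r f"
  by (simp add: level_avg_def sum_nonneg)

lemma cesaro_mean_nonneg [simp]: "0 \<le> cesaro_mean f n"
  by (simp add: cesaro_mean_def sum_nonneg level_avg_nonneg)

lemma cesaro_mean_mono: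
  assumes "\<And>v. depth E rt v \<le> n \<Longrightarrow> cmod (f v) \<le> cmod (g v)"
  shows "cesaro_mean f n \<le> cesaro_mean g n"
  unfolding cesaro_mean_def level_avg_def
  using assms by (intro mult_left_mono sum_mono) auto

lemma ces_term_mono:
  assumes "\<And>v. depth E rt v \<le> n \<Longrightarrow> cmod (f v) \<le> cmod (g v)"
  shows "ces_term E rt p f n \<le> ces_term E rt p g n"
  unfolding ces_term_eq using p by (intro powr_mono2 cesaro_mean_mono assms) auto

lemma cesaro_mean_add:
  "cesaro_mean (\<lambda>v. f v + g v) n \<le> cesaro_mean f n + cesaro_mean g n"
proof -
  have "level_avg E rt r (\<lambda>v. f v + g v) \<le> level_avg E rt r f + level_avg E rt r g" for r
    unfolding level_avg_def
    by (simp add: add_divide_distrib[symmetric] sum.distrib[symmetric] norm_triangle_ineq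
        divide_right_mono sum_mono)
  then have "(\<Sum>r=0..n. level_avg E rt r (\<lambda>v. f v + g v))
      \<le> (\<Sum>r=0..n. level_avg E rt r f) + (\<Sum>r=0..n. level_avg E rt r g)"
    by (simp add: sum.distrib[symmetric] sum_mono)
  then show ?thesis
    by (simp add: cesaro_mean_def add_divide_distrib[symmetric] divide_right_mono)
qed

lemma cesaro_mean_scale: "cesaro_mean (\<lambda>v. a * f v) n = cmod a * cesaro_mean f n"
proof -
  have "level_avg E rt r (\<lambda>v. a * f v) = cmod a * level_avg E rt r f" for r
    by (simp add: level_avg_def norm_mult sum_distrib_left[symmetric])
  then show ?thesis
    by (simp add: cesaro_mean_def sum_distrib_left[symmetric])
qed

lemma cmod_le_cesaro_mean:
  "cmod (f v) \<le> real (c (depth E rt v)) * (real (depth E rt v) + 1) *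
     cesaro_mean f (depth E rt v)"
proof -
  let ?n = "depth E rt v"
  have "cmod (f v) \<le> (\<Sum>u\<in>level E rt ?n. cmod (f u))"
    by (rule member_le_sum) auto
  also have "\<dots> = real (c ?n) * level_avg E rt ?n f"
    using level_card_pos[of ?n] by (simp add: level_avg_def)
  also have "\<dots> \<le> real (c ?n) * (\<Sum>r=0..?n. level_avg E rt r f)"
    by (intro mult_left_mono member_le_sum) (auto simp: level_avg_nonneg)
  also have "\<dots> = real (c ?n) * (real ?n + 1) * cesaro_mean f ?n"
    by (simp add: cesaro_mean_def)
  finally show ?thesis .
qed

lemma CesD: "f \<in> \<C> \<Longrightarrow> summable (ces_term E rt p f)"
  by (simp add: Ces_def)

lemma ces_norm_nonneg [simp]: "0 \<le> nrm f"
  by (simp add: ces_norm_def)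

lemma ces_norm_powr: "f \<in> \<C> \<Longrightarrow> nrm f powr p = (\<Sum>n. ces_term E rt p f n)"
  using p by (simp add: ces_norm_def powr_powr suminf_nonneg CesD)

lemma ces_norm_le_iff:
  assumes "f \<in> \<C>" "0 \<le> A"
  shows "nrm f \<le> A \<longleftrightarrow> (\<Sum>n. ces_term E rt p f n) \<le> A powr p"
proof -
  have "nrm f \<le> A \<longleftrightarrow> nrm f powr p \<le> A powr p"
    using p assms powr_mono2[of p "nrm f" A] powr_less_mono2[of p A "nrm f"]
    by (auto simp: not_le[symmetric])
  then show ?thesis by (simp add: ces_norm_powr assms)
qed

lemma cesaro_mean_le_norm:
  assumes "f \<in> \<C>"
  shows "cesaro_mean f n \<le> nrm f"
proof (rule ccontr)
  assume "\<not> cesaro_mean f n \<le> nrm f"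
  then have "nrm f powr p < cesaro_mean f n powr p"
    using p by (intro powr_less_mono2) auto
  moreover have "cesaro_mean f n powr p \<le> (\<Sum>n. ces_term E rt p f n)"
    using sum_le_suminf[OF CesD[OF assms], of "{n}"] by (simp add: ces_term_eq[of f n])
  ultimately show False
    by (simp add: ces_norm_powr assms)
qed

text \<open>A bound for the norm of the evaluation at \<open>v\<close>.\<close>

definition eval_const :: "'v \<Rightarrow> real" where
  "eval_const v = real (c (depth E rt v)) * (real (depth E rt v) + 1)"

lemma eval_const_pos: "0 < eval_const v"
  using level_card_pos[of "depth E rt v"] by (simp add: eval_const_def)

lemma cmod_le_norm:
  assumes "f \<in> \<C>"
  shows "cmod (f v) \<le> eval_const v * nrm f"
proof -
  have "cmod (f v) \<le> eval_const v * cesaro_mean f (depth E rt v)"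
    using cmod_le_cesaro_mean by (simp add: eval_const_def)
  also have "\<dots> \<le> eval_const v * nrm f"
    using eval_const_pos[of v] by (intro mult_left_mono cesaro_mean_le_norm assms) simp
  finally show ?thesis .
qed

lemma Ces_mono:
  assumes "g \<in> \<C>" "\<And>v. cmod (f v) \<le> cmod (g v)"
  shows "f \<in> \<C>"
  unfolding Ces_def mem_Collect_eq
  using assms by (intro summable_comparison_test'[OF CesD[OF assms(1)], of 0])
    (auto intro: ces_term_mono)

lemma Ces_scale:
  assumes "f \<in> \<C>"
  shows "(\<lambda>v. a * f v) \<in> \<C>" "nrm (\<lambda>v. a * f v) = cmod a * nrm f"
proof -
  have eq: "ces_term E rt p (\<lambda>v. a * f v) = (\<lambda>n. cmod a powr p * ces_term E rt p f n)"
    by (simp add: fun_eq_iff ces_term_eq cesaro_mean_scale powr_mult)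
  show "(\<lambda>v. a * f v) \<in> \<C>"
    using CesD[OF assms] by (simp add: Ces_def eq summable_mult)
  show "nrm (\<lambda>v. a * f v) = cmod a * nrm f"
    using p CesD[OF assms]
    by (simp add: ces_norm_def eq suminf_mult powr_mult suminf_nonneg powr_powr)
qed

text \<open>The slack \<open>\<epsilon>\<close> makes the bounds in Minkowski's inequality positive even if a norm is 0.\<close>

lemma Ces_add_approx:
  assumes "f \<in> \<C>" "g \<in> \<C>" "\<epsilon> > 0"
  shows "(\<lambda>v. f v + g v) \<in> \<C>" "nrm (\<lambda>v. f v + g v) \<le> nrm f + nrm g + \<epsilon>"
proof -
  note M = Minkowski_suminf_bound[of p "cesaro_mean f" "cesaro_mean g"
      "nrm f + \<epsilon> / 2" "nrm g + \<epsilon> / 2", folded ces_term_eq]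
  have *: "(\<Sum>n. ces_term E rt p h n) \<le> (nrm h + \<epsilon> / 2) powr p" if "h \<in> \<C>" for h
    using that ces_norm_le_iff[of h "nrm h + \<epsilon> / 2"] assms by (simp add: add_nonneg_nonneg)
  have pos: "0 < nrm h + \<epsilon> / 2" for h
    using assms by (simp add: add_nonneg_pos)
  have sum: "summable (\<lambda>n. (cesaro_mean f n + cesaro_mean g n) powr p)"
    and le: "(\<Sum>n. (cesaro_mean f n + cesaro_mean g n) powr p) \<le> (nrm f + nrm g + \<epsilon>) powr p"
    using M assms p pos *  by (simp_all add: CesD add.assoc add.left_commute)
  have term_le: "ces_term E rt p (\<lambda>v. f v + g v) n \<le> (cesaro_mean f n + cesaro_mean g n) powr p"
    for n
    unfolding ces_term_eq using p by (intro powr_mono2 cesaro_mean_add) auto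
  show C: "(\<lambda>v. f v + g v) \<in> \<C>"
    unfolding Ces_def mem_Collect_eq using term_le
    by (intro summable_comparison_test'[OF sum, of 0]) auto
  have "(\<Sum>n. ces_term E rt p (\<lambda>v. f v + g v) n)
      \<le> (\<Sum>n. (cesaro_mean f n + cesaro_mean g n) powr p)"
    by (intro suminf_le term_le CesD C sum)
  with le show "nrm (\<lambda>v. f v + g v) \<le> nrm f + nrm g + \<epsilon>"
    using assms by (subst ces_norm_le_iff[OF C]) (auto intro: add_nonneg_nonneg)
qed

lemma Ces_add: "f \<in> \<C> \<Longrightarrow> g \<in> \<C> \<Longrightarrow> (\<lambda>v. f v + g v) \<in> \<C>"
  using Ces_add_approx(1)[of f g 1] by simp

lemma ces_norm_triangle: "f \<in> \<C> \<Longrightarrow> g \<in> \<C> \<Longrightarrow> nrm (\<lambda>v. f v + g v) \<le> nrm f + nrm g"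
  by (rule field_le_epsilon) (rule Ces_add_approx(2))

lemma Ces_uminus: "f \<in> \<C> \<Longrightarrow> (\<lambda>v. - f v) \<in> \<C>"
  using Ces_scale(1)[of f "-1"] by simp

lemma Ces_diff: "f \<in> \<C> \<Longrightarrow> g \<in> \<C> \<Longrightarrow> (\<lambda>v. f v - g v) \<in> \<C>"
  using Ces_add[of f "\<lambda>v. - g v"] Ces_uminus by simp

lemma ces_norm_diff_commute: "nrm (\<lambda>v. f v - g v) = nrm (\<lambda>v. g v - f v)"
  by (simp add: ces_norm_def ces_term_def level_avg_def norm_minus_commute)

lemma ces_norm_diff_triangle:
  assumes "f \<in> \<C>" "g \<in> \<C>" "h \<in> \<C>"
  shows "nrm (\<lambda>v. f v - h v) \<le> nrm (\<lambda>v. f v - g v) + nrm (\<lambda>v. g v - h v)"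
  using ces_norm_triangle[OF Ces_diff[OF assms(1,2)] Ces_diff[OF assms(2,3)]] by simp

lemma ces_term_zero [simp]: "ces_term E rt p (\<lambda>v. 0) = (\<lambda>n. 0)"
  by (simp add: fun_eq_iff ces_term_def level_avg_def)

lemma zero_in_Ces [simp]: "(\<lambda>v. 0) \<in> \<C>" and ces_norm_zero [simp]: "nrm (\<lambda>v. 0) = 0"
  by (simp_all add: Ces_def ces_norm_def)

sublocale Metric_space \<C> "\<lambda>f g. nrm (\<lambda>v. f v - g v)"
proof
  fix f g :: "'v \<Rightarrow> complex"
  assume C: "f \<in> \<C>" "g \<in> \<C>"
  show "nrm (\<lambda>v. f v - g v) = 0 \<longleftrightarrow> f = g"
  proof
    assume "nrm (\<lambda>v. f v - g v) = 0"
    then have "cmod (f v - g v) \<le> 0" for v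
      using cmod_le_norm[OF Ces_diff[OF C], of v] by simp
    then show "f = g" by auto
  qed simp
qed (simp_all add: ces_norm_diff_triangle, rule ces_norm_diff_commute)

abbreviation "X \<equiv> ces_topology E rt p"

lemma ces_topology_eq: "X = mtopology"
  by (simp add: ces_topology_def)

text \<open>
  The Fatou property: each partial sum of the series involves finitely many vertices only, so
  that it passes to pointwise limits.
\<close>

lemma Ces_Fatou:
  assumes f: "\<And>k. f k \<in> \<C>" "\<And>k. nrm (f k) \<le> A"
    and lim: "\<And>v. (\<lambda>k. f k v) \<longlonglongrightarrow> g v"
  shows "g \<in> \<C>" "nrm g \<le> A"
proof -
  have A: "0 \<le> A" using f(2)[of 0] ces_norm_nonneg[of "f 0"] by linarith
  have term_lim: "(\<lambda>k. ces_term E rt p (f k) n) \<longlonglongrightarrow> ces_term E rt p g n" for n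
  proof -
    have "(\<lambda>k. cesaro_mean (f k) n) \<longlonglongrightarrow> cesaro_mean g n"
      unfolding cesaro_mean_def level_avg_def
      by (intro tendsto_mult tendsto_const tendsto_sum tendsto_norm lim)
    then show ?thesis
      unfolding ces_term_eq using p by (intro tendsto_powr2 tendsto_const) auto
  qed
  have bound: "(\<Sum>n<m. ces_term E rt p g n) \<le> A powr p" for m
  proof (rule LIMSEQ_le_const2)
    show "(\<lambda>k. \<Sum>n<m. ces_term E rt p (f k) n) \<longlonglongrightarrow> (\<Sum>n<m. ces_term E rt p g n)"
      by (intro tendsto_sum term_lim)
    have "(\<Sum>n<m. ces_term E rt p (f k) n) \<le> A powr p" for k
      using sum_le_suminf[OF CesD[OF f(1)[of k]], of "{..<m}"] ces_norm_le_iff[OF f(1) A] f(2)[of k]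
      by (auto intro: order_trans)
    then show "\<exists>N. \<forall>k\<ge>N. (\<Sum>n<m. ces_term E rt p (f k) n) \<le> A powr p" by blast
  qed
  show g: "g \<in> \<C>"
    unfolding Ces_def mem_Collect_eq by (rule summableI_nonneg_bounded[OF _ bound]) simp
  show "nrm g \<le> A"
    unfolding ces_norm_le_iff[OF g A] by (intro suminf_le_const CesD g bound)
qed

lemma Ces_mcomplete: mcomplete
  unfolding mcomplete_def
proof (intro allI impI)
  fix \<sigma> assume "MCauchy \<sigma>"
  then have C: "\<And>n. \<sigma> n \<in> \<C>"
    and cauchy: "\<And>\<epsilon>. \<epsilon> > 0 \<Longrightarrow> \<exists>N. \<forall>n n'. N \<le> n \<longrightarrow> N \<le> n' \<longrightarrow> nrm (\<lambda>v. \<sigma> n v - \<sigma> n' v) < \<epsilon>"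
    unfolding MCauchy_def by blast+
  have "Cauchy (\<lambda>n. \<sigma> n v)" for v
  proof (rule CauchyI)
    fix e :: real assume "e > 0"
    then obtain N where N: "\<And>n n'. N \<le> n \<Longrightarrow> N \<le> n' \<Longrightarrow>
        nrm (\<lambda>u. \<sigma> n u - \<sigma> n' u) < e / eval_const v"
      using cauchy[of "e / eval_const v"] eval_const_pos[of v] by auto
    have "cmod (\<sigma> n v - \<sigma> n' v) < e" if "N \<le> n" "N \<le> n'" for n n'
    proof -
      have "cmod (\<sigma> n v - \<sigma> n' v) \<le> eval_const v * nrm (\<lambda>u. \<sigma> n u - \<sigma> n' u)"
        by (rule cmod_le_norm[OF Ces_diff[OF C C]])
      also have "\<dots> < e"
        using N[OF that] eval_const_pos[of v] by (simp add: field_simps)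
      finally show ?thesis .
    qed
    then show "\<exists>M. \<forall>m\<ge>M. \<forall>n\<ge>M. cmod (\<sigma> m v - \<sigma> n v) < e" by blast
  qed
  then have "\<exists>l. (\<lambda>n. \<sigma> n v) \<longlonglongrightarrow> l" for v
    by (auto simp: Cauchy_convergent_iff convergent_def)
  then obtain g where g: "\<And>v. (\<lambda>n. \<sigma> n v) \<longlonglongrightarrow> g v" by metis
  have near: "\<exists>N. \<forall>n\<ge>N. g \<in> \<C> \<and> nrm (\<lambda>v. \<sigma> n v - g v) < \<epsilon>" if \<epsilon>: "\<epsilon> > 0" for \<epsilon>
  proof -
    obtain N where N: "\<And>n n'. N \<le> n \<Longrightarrow> N \<le> n' \<Longrightarrow> nrm (\<lambda>v. \<sigma> n v - \<sigma> n' v) < \<epsilon> / 2"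
      using cauchy[of "\<epsilon> / 2"] \<epsilon> by auto
    have "g \<in> \<C> \<and> nrm (\<lambda>v. \<sigma> n v - g v) < \<epsilon>" if n: "n \<ge> N" for n
    proof -
      have F: "(\<lambda>v. \<sigma> n v - g v) \<in> \<C>" "nrm (\<lambda>v. \<sigma> n v - g v) \<le> \<epsilon> / 2"
      proof -
        have 1: "\<And>k. (\<lambda>v. \<sigma> n v - \<sigma> (k + N) v) \<in> \<C>" by (intro Ces_diff C)
        have 2: "\<And>k. nrm (\<lambda>v. \<sigma> n v - \<sigma> (k + N) v) \<le> \<epsilon> / 2"
          using N n by (simp add: less_imp_le)
        have 3: "\<And>v. (\<lambda>k. \<sigma> n v - \<sigma> (k + N) v) \<longlonglongrightarrow> \<sigma> n v - g v"
          by (intro tendsto_diff tendsto_const LIMSEQ_ignore_initial_segment g)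
        show "(\<lambda>v. \<sigma> n v - g v) \<in> \<C>" "nrm (\<lambda>v. \<sigma> n v - g v) \<le> \<epsilon> / 2"
          using Ces_Fatou[OF 1 2 3] by auto
      qed
      with Ces_diff[OF C F(1), of n] \<epsilon> show ?thesis by simp
    qed
    then show ?thesis by blast
  qed
  have "g \<in> \<C>" using near[of 1] by auto
  then have "limitin mtopology \<sigma> g sequentially"
    unfolding limit_metric_sequentially using C near by blast
  then show "\<exists>x. limitin mtopology \<sigma> x sequentially" by blast
qed

text \<open>
  The Cesaro means of a function that vanishes on the levels before \<open>m\<close> start with the \<open>m\<close>-th,
  so that the tail of the convergent series for \<open>f\<close> dominates all truncations of \<open>f\<close> uniformly.
\<close>

lemma Ces_tail_small:
  assumes f: "f \<in> \<C>" and \<epsilon>: "\<epsilon> > 0"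
  shows "\<exists>m0. \<forall>m\<ge>m0. \<forall>g. (\<forall>v. cmod (g v) \<le> (if m \<le> depth E rt v then cmod (f v) else 0)) \<longrightarrow>
           g \<in> \<C> \<and> nrm g < \<epsilon>"
proof -
  have "0 < (\<epsilon> / 2) powr p" using \<epsilon> by simp
  from suminf_exist_split[OF this CesD[OF f]] obtain m0 where
    m0: "\<And>m. m \<ge> m0 \<Longrightarrow> norm (\<Sum>i. ces_term E rt p f (i + m)) < (\<epsilon> / 2) powr p" by blast
  have "g \<in> \<C> \<and> nrm g < \<epsilon>"
    if m: "m \<ge> m0" and g: "\<And>v. cmod (g v) \<le> (if m \<le> depth E rt v then cmod (f v) else 0)" for m g
  proof -
    have le: "\<And>v. cmod (g v) \<le> cmod (f v)"
      using g norm_ge_zero order_trans by (metis (full_types))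
    have C: "g \<in> \<C>" by (rule Ces_mono[OF f le])
    have "ces_term E rt p g n = 0" if "n < m" for n
    proof -
      have "cmod (g v) \<le> cmod 0" if "depth E rt v \<le> n" for v
        using g[of v] that \<open>n < m\<close> by simp
      then have "ces_term E rt p g n \<le> ces_term E rt p (\<lambda>v. 0) n"
        by (intro ces_term_mono) simp
      then show ?thesis using ces_term_nonneg[of g n] by simp
    qed
    then have "(\<Sum>n. ces_term E rt p g n) = (\<Sum>n. ces_term E rt p g (n + m))"
      using suminf_split_initial_segment[OF CesD[OF C], of m] by simp
    also have "\<dots> \<le> (\<Sum>n. ces_term E rt p f (n + m))"
      by (intro suminf_le ces_term_mono le) (simp_all add: CesD C f summable_ignore_initial_segment)
    also have "\<dots> \<le> (\<epsilon> / 2) powr p"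
      using m0[OF m] by simp
    finally have "nrm g \<le> \<epsilon> / 2"
      using ces_norm_le_iff[OF C, of "\<epsilon> / 2"] \<epsilon> by simp
    with C \<epsilon> show ?thesis by simp
  qed
  then show ?thesis by blast
qed

abbreviation unit_vector :: "'v \<Rightarrow> 'v \<Rightarrow> complex" where
  "unit_vector v \<equiv> (\<lambda>u. if u = v then 1 else 0)"

text \<open>The Cesaro means decay like \<open>1 / n\<close>, so that their \<open>p\<close>-th powers are summable as \<open>p > 1\<close>.\<close>

lemma unit_vector_in_Ces: "unit_vector v \<in> \<C>"
proof -
  have avg: "level_avg E rt r (unit_vector v) \<le> (if r = depth E rt v then 1 else 0)" for r
  proof -
    have "(\<Sum>u\<in>level E rt r. cmod (unit_vector v u)) = (if r = depth E rt v then 1 else 0)"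
      by (simp add: if_distrib[of cmod] sum.delta cong: if_cong)
    then show ?thesis
      using level_card_pos[of r] by (simp add: level_avg_def Suc_leI)
  qed
  have "cesaro_mean (unit_vector v) n \<le> 1 / (real n + 1)" for n
  proof -
    have "(\<Sum>r=0..n. level_avg E rt r (unit_vector v)) \<le> (\<Sum>r=0..n. if r = depth E rt v then 1 else 0)"
      by (intro sum_mono avg)
    also have "\<dots> \<le> (1::real)" by (simp add: sum.delta)
    finally show ?thesis
      by (simp add: cesaro_mean_def divide_right_mono)
  qed
  then have le: "ces_term E rt p (unit_vector v) n \<le> real (Suc n) powr (- p)" for n
    unfolding ces_term_eq
    using powr_mono2[of p "cesaro_mean (unit_vector v) n" "1 / (real n + 1)"] p
    by (simp add: powr_minus_divide powr_divide add.commute)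
  have "summable (\<lambda>n. real (Suc n) powr (- p))"
    using p summable_real_powr_iff[of "- p"] summable_Suc_iff[of "\<lambda>n. real n powr (- p)"] by simp
  then show ?thesis
    unfolding Ces_def mem_Collect_eq
    by (rule summable_comparison_test'[of _ 0]) (use le in auto)
qed

lemma Ces_sum:
  assumes "finite F" "\<And>i. i \<in> F \<Longrightarrow> f i \<in> \<C>"
  shows "(\<lambda>v. \<Sum>i\<in>F. f i v) \<in> \<C>" "nrm (\<lambda>v. \<Sum>i\<in>F. f i v) \<le> (\<Sum>i\<in>F. nrm (f i))"
proof -
  have "(\<lambda>v. \<Sum>i\<in>F. f i v) \<in> \<C> \<and> nrm (\<lambda>v. \<Sum>i\<in>F. f i v) \<le> (\<Sum>i\<in>F. nrm (f i))"
    using assms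
  proof (induction F rule: finite_induct)
    case (insert i F)
    then show ?case
      using ces_norm_triangle[of "f i" "\<lambda>v. \<Sum>i\<in>F. f i v"]
      by (auto intro!: Ces_add)
  qed simp
  then show "(\<lambda>v. \<Sum>i\<in>F. f i v) \<in> \<C>" "nrm (\<lambda>v. \<Sum>i\<in>F. f i v) \<le> (\<Sum>i\<in>F. nrm (f i))"
    by auto
qed

definition finite_depth :: "('v \<Rightarrow> complex) \<Rightarrow> bool" where
  "finite_depth f \<longleftrightarrow> (\<exists>m. \<forall>v. m \<le> depth E rt v \<longrightarrow> f v = 0)"

lemma expand_unit_vectors:
  assumes "\<And>v. m \<le> depth E rt v \<Longrightarrow> f v = 0"
  shows "f = (\<lambda>u. \<Sum>v\<in>{v. depth E rt v < m}. f v * unit_vector v u)"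
proof
  fix u
  show "f u = (\<Sum>v\<in>{v. depth E rt v < m}. f v * unit_vector v u)"
    using assms[of u] finite_depth_less[of m]
    by (simp add: if_distrib[of "(*) _"] sum.delta' not_less cong: if_cong)
qed

text \<open>
  Cut off the tail; the finitely many remaining values can be moved into a dense set \<open>Q\<close> at a cost
  that is controlled by the norms of the finitely many unit vectors involved.
\<close>

lemma finite_depth_approximation:
  assumes f: "f \<in> \<C>" and \<epsilon>: "\<epsilon> > 0"
    and Q: "\<And>z r. r > 0 \<Longrightarrow> \<exists>q\<in>Q. cmod (z - q) < r"
  shows "\<exists>g. finite_depth g \<and> (\<forall>v. g v \<in> Q \<union> {0}) \<and> g \<in> \<C> \<and> nrm (\<lambda>v. f v - g v) < \<epsilon>"
proof -
  obtain m where m: "\<And>g. (\<And>v. cmod (g v) \<le> (if m \<le> depth E rt v then cmod (f v) else 0)) \<Longrightarrow>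
      g \<in> \<C> \<and> nrm g < \<epsilon> / 2"
    using Ces_tail_small[OF f, of "\<epsilon> / 2"] \<epsilon> by auto
  let ?F = "{v. depth E rt v < m}"
  define S where "S = 1 + (\<Sum>v\<in>?F. nrm (unit_vector v))"
  have S: "0 < S" by (simp add: S_def add_pos_nonneg sum_nonneg)
  define q where "q v = (SOME q. q \<in> Q \<and> cmod (f v - q) < \<epsilon> / 2 / S)" for v
  have "\<exists>q. q \<in> Q \<and> cmod (f v - q) < \<epsilon> / 2 / S" for v
    using Q[of "\<epsilon> / 2 / S" "f v"] S \<epsilon> by auto
  then have q: "q v \<in> Q" "cmod (f v - q v) < \<epsilon> / 2 / S" for v
    using someI_ex[of "\<lambda>q. q \<in> Q \<and> cmod (f v - q) < \<epsilon> / 2 / S"] by (auto simp: q_def)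
  define g where "g v = (if depth E rt v < m then q v else 0)" for v
  define h where "h v = (if depth E rt v < m then f v - q v else 0)" for v
  define k where "k v = (if depth E rt v < m then 0 else f v)" for v
  have k: "k \<in> \<C>" "nrm k < \<epsilon> / 2"
    using m[of k] by (auto simp: k_def)
  have h_eq: "h = (\<lambda>u. \<Sum>v\<in>?F. h v * unit_vector v u)"
    by (rule expand_unit_vectors) (simp add: h_def)
  have h_C: "h \<in> \<C>"
    by (subst h_eq) (intro Ces_sum finite_depth_less Ces_scale unit_vector_in_Ces)
  have "nrm h \<le> (\<Sum>v\<in>?F. nrm (\<lambda>u. h v * unit_vector v u))"
    by (subst h_eq) (intro Ces_sum finite_depth_less Ces_scale unit_vector_in_Ces)
  also have "\<dots> = (\<Sum>v\<in>?F. cmod (h v) * nrm (unit_vector v))"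
    by (intro sum.cong refl Ces_scale unit_vector_in_Ces)
  also have "\<dots> \<le> (\<Sum>v\<in>?F. \<epsilon> / 2 / S * nrm (unit_vector v))"
    using q(2) by (intro sum_mono mult_right_mono) (auto simp: h_def intro: less_imp_le)
  also have "\<dots> = \<epsilon> / 2 / S * (S - 1)"
    by (subst sum_distrib_left[symmetric]) (simp add: S_def)
  also have "\<dots> \<le> \<epsilon> / 2"
    using S \<epsilon> by (simp add: field_simps)
  finally have h: "nrm h \<le> \<epsilon> / 2" .
  have diff: "(\<lambda>v. f v - g v) = (\<lambda>v. h v + k v)"
    by (auto simp: g_def h_def k_def)
  have "nrm (\<lambda>v. f v - g v) < \<epsilon>"
    unfolding diff using ces_norm_triangle[OF h_C k(1)] h k(2) by linarith
  moreover have "g \<in> \<C>"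
  proof -
    have "(\<lambda>v. f v - (h v + k v)) \<in> \<C>" by (intro Ces_diff Ces_add f h_C k)
    moreover have "(\<lambda>v. f v - (h v + k v)) = g"
      by (auto simp: g_def h_def k_def)
    ultimately show ?thesis by simp
  qed
  moreover have "finite_depth g"
    unfolding finite_depth_def by (intro exI[of _ m]) (simp add: g_def)
  moreover have "\<forall>v. g v \<in> Q \<union> {0}" by (simp add: g_def q)
  ultimately show ?thesis by blast
qed

lemma finite_depth_dense:
  assumes "f \<in> \<C>" "\<epsilon> > 0"
  obtains g where "finite_depth g" "g \<in> \<C>" "nrm (\<lambda>v. f v - g v) < \<epsilon>"
proof -
  have "\<exists>q\<in>UNIV. cmod (z - q) < r" if "r > 0" for z r
    using that by (intro bexI[of _ z]) auto
  from finite_depth_approximation[OF assms this] that show ?thesis by blast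
qed

lemma Ces_separable:
  obtains D where "countable D" "D \<subseteq> \<C>"
    "\<And>f \<epsilon>. f \<in> \<C> \<Longrightarrow> \<epsilon> > 0 \<Longrightarrow> \<exists>g\<in>D. nrm (\<lambda>v. f v - g v) < \<epsilon>"
proof -
  obtain Q :: "complex set" where Q: "countable Q"
    "\<And>U. open U \<Longrightarrow> U \<noteq> {} \<Longrightarrow> \<exists>q\<in>Q. q \<in> U"
    using countable_dense_setE by blast
  have Q': "\<exists>q\<in>Q. cmod (z - q) < r" if "r > 0" for z r
    using Q(2)[of "ball z r"] that by (auto simp: dist_norm)
  define D where "D = {g. finite_depth g \<and> (\<forall>v. g v \<in> Q \<union> {0}) \<and> g \<in> \<C>}"
  have "D \<subseteq> (\<Union>m. (\<lambda>g v. if depth E rt v < m then g v else 0) `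
      (\<Pi>\<^sub>E v\<in>{v. depth E rt v < m}. Q \<union> {0}))"
  proof
    fix g assume "g \<in> D"
    then obtain m where m: "\<And>v. m \<le> depth E rt v \<Longrightarrow> g v = 0" and gQ: "\<And>v. g v \<in> Q \<union> {0}"
      by (auto simp: D_def finite_depth_def)
    have "g = (\<lambda>v. if depth E rt v < m then restrict g {v. depth E rt v < m} v else 0)"
      using m by (auto simp: fun_eq_iff not_less)
    moreover have "restrict g {v. depth E rt v < m} \<in> (\<Pi>\<^sub>E v\<in>{v. depth E rt v < m}. Q \<union> {0})"
      using gQ by (auto simp del: Un_insert_right)
    ultimately show "g \<in> (\<Union>m. (\<lambda>g v. if depth E rt v < m then g v else 0) `
      (\<Pi>\<^sub>E v\<in>{v. depth E rt v < m}. Q \<union> {0}))" by blast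
  qed
  moreover have "countable (\<Union>m. (\<lambda>g v. if depth E rt v < m then g v else 0) `
      (\<Pi>\<^sub>E v\<in>{v. depth E rt v < m}. Q \<union> {0}))"
    using Q(1) by (intro countable_UN countable_image countable_PiE finite_depth_less) auto
  ultimately have "countable D" by (rule countable_subset)
  moreover have "D \<subseteq> \<C>" by (auto simp: D_def)
  moreover have "\<exists>g\<in>D. nrm (\<lambda>v. f v - g v) < \<epsilon>" if "f \<in> \<C>" "\<epsilon> > 0" for f \<epsilon>
    using finite_depth_approximation[OF that Q'] by (auto simp: D_def)
  ultimately show ?thesis using that by blast
qed

lemma dense_in_iff:
  "dense_in X A \<longleftrightarrow> A \<subseteq> \<C> \<and> (\<forall>f\<in>\<C>. \<forall>\<epsilon>>0. \<exists>g\<in>A. nrm (\<lambda>v. f v - g v) < \<epsilon>)"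
proof (cases "A \<subseteq> \<C>")
  case True
  then have "(\<exists>g\<in>A. g \<in> mball f \<epsilon>) \<longleftrightarrow> (\<exists>g\<in>A. nrm (\<lambda>v. f v - g v) < \<epsilon>)" if "f \<in> \<C>" for f \<epsilon>
    using that by (auto simp: in_mball)
  with True show ?thesis
    unfolding dense_in_def ces_topology_eq topspace_mtopology metric_closure_of
    by (simp add: set_eq_iff) blast
qed (simp add: dense_in_def ces_topology_eq)

end

section \<open>Birkhoff's transitivity theorem\<close>

text \<open>
  A vector has a dense orbit if and only if its orbit meets every ball with centre in a countable
  dense set and radius \<open>1 / (k + 1)\<close>. By mixing and continuity each of these countably many
  conditions defines a dense open set, so that the Baire category theorem applies.
\<close>

theorem (in Metric_space) mixing_imp_hypercyclic:
  assumes complete: mcomplete and nonempty: "M \<noteq> {}"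
    and D: "countable D" "D \<subseteq> M" "\<And>x \<epsilon>. x \<in> M \<Longrightarrow> \<epsilon> > 0 \<Longrightarrow> \<exists>y\<in>D. d x y < \<epsilon>"
    and cont: "continuous_map mtopology mtopology S"
    and mixing: "topologically_mixing mtopology S"
  shows "hypercyclic mtopology S"
proof -
  have cont_pow: "continuous_map mtopology mtopology (S ^^ n)" for n
  proof (induction n)
    case (Suc n)
    then show ?case
      using continuous_map_compose[OF Suc cont] by (simp add: o_def)
  qed (simp add: id_def)
  define G where "G y k = {x \<in> M. \<exists>n. (S ^^ n) x \<in> mball y (1 / real (Suc k))}" for y k
  have G_open: "openin mtopology (G y k)" for y k
  proof -
    have "G y k = (\<Union>n. {x \<in> topspace mtopology. (S ^^ n) x \<in> mball y (1 / real (Suc k))})"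
      by (auto simp: G_def)
    then show ?thesis
      using openin_continuous_map_preimage[OF cont_pow openin_mball] by (auto intro!: openin_Union)
  qed
  have G_dense: "mtopology closure_of G y k = M" if y: "y \<in> D" for y k
  proof -
    have "\<exists>z\<in>G y k. z \<in> mball x r" if x: "x \<in> M" and r: "r > 0" for x r
    proof -
      have "x \<in> mball x r" "y \<in> mball y (1 / real (Suc k))"
        using x y r D(2) by auto
      then have "mball x r \<noteq> {}" "mball y (1 / real (Suc k)) \<noteq> {}"
        by blast+
      then have "\<exists>n0. \<forall>n\<ge>n0. (S ^^ n) ` mball x r \<inter> mball y (1 / real (Suc k)) \<noteq> {}"
        using mixing openin_mball by (simp add: topologically_mixing_def)
      then obtain n where "(S ^^ n) ` mball x r \<inter> mball y (1 / real (Suc k)) \<noteq> {}"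
        using order_refl by metis
      then obtain z where "z \<in> mball x r" "(S ^^ n) z \<in> mball y (1 / real (Suc k))" by blast
      then show ?thesis unfolding G_def by (intro bexI[of _ z]) auto
    qed
    then show ?thesis
      unfolding metric_closure_of by blast
  qed
  define I where "I = \<Inter>((\<lambda>(y, k). G y k) ` (D \<times> UNIV))"
  have "mtopology closure_of I = M"
    unfolding I_def using complete D(1) G_open G_dense by (intro metric_Baire_category) auto
  moreover obtain x0 where "x0 \<in> M" using nonempty by auto
  ultimately have "x0 \<in> {x \<in> M. \<forall>r>0. \<exists>y\<in>I. y \<in> mball x r}"
    by (simp only: metric_closure_of)
  then obtain x where xI: "x \<in> I" "x \<in> mball x0 1"
    using zero_less_one by blast
  then have x: "x \<in> M" "\<And>y k. y \<in> D \<Longrightarrow> x \<in> G y k"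
    by (auto simp: I_def)
  have orbit: "(S ^^ n) x \<in> M" for n
    using continuous_map_image_subset_topspace[OF cont_pow[of n]] x(1) by auto
  have "\<exists>y\<in>{(S ^^ n) x |n. True}. y \<in> mball z r" if z: "z \<in> M" and r: "r > 0" for z r
  proof -
    obtain k where k: "1 / real (Suc k) < r / 2"
      using r nat_approx_posE[of "r / 2"] by auto
    obtain y where y: "y \<in> D" "d z y < r / 2"
      using D(3)[OF z, of "r / 2"] r by auto
    then obtain n where n: "d y ((S ^^ n) x) < 1 / real (Suc k)"
      using x(2)[OF y(1), of k] by (auto simp: G_def)
    have "d z ((S ^^ n) x) < r"
      using triangle[OF z subsetD[OF D(2) y(1)] orbit[of n]] y(2) n k by linarith
    then show ?thesis using z orbit[of n] by auto
  qed
  then have "mtopology closure_of {(S ^^ n) x |n. True} = M"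
    unfolding metric_closure_of by blast
  then show ?thesis
    unfolding hypercyclic_def dense_in_def using x(1) orbit by auto
qed

section \<open>Fixed vectors on descendant subtrees and their slices\<close>

locale cesaro_shift = cesaro_tree E rt p
  for E :: "('v \<times> 'v) set" and rt :: 'v and p :: real +
  fixes lam :: "'v \<Rightarrow> complex"
  assumes bounded: "bounded_operator_Ces E rt p (backward_shift E lam)"
begin

abbreviation "B \<equiv> backward_shift E lam"

lemma B_in_Ces: "f \<in> \<C> \<Longrightarrow> B f \<in> \<C>"
  using bounded by (auto simp: bounded_operator_Ces_def)

lemma B_pow_in_Ces: "f \<in> \<C> \<Longrightarrow> (B ^^ n) f \<in> \<C>"
  by (induction n) (auto simp: B_in_Ces)

lemma B_add: "B (\<lambda>v. f v + g v) = (\<lambda>v. B f v + B g v)"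
  by (simp add: backward_shift_def fun_eq_iff distrib_left sum.distrib)

lemma B_diff: "B (\<lambda>v. f v - g v) = (\<lambda>v. B f v - B g v)"
  by (simp add: backward_shift_def fun_eq_iff right_diff_distrib sum_subtractf)

lemma B_sum: "B (\<lambda>u. \<Sum>i\<in>I. a i * g i u) = (\<lambda>u. \<Sum>i\<in>I. a i * B (g i) u)"
  by (simp add: backward_shift_def fun_eq_iff sum_distrib_left mult.left_commute
      sum.swap[of _ I])

lemma B_pow_add: "(B ^^ n) (\<lambda>v. f v + g v) = (\<lambda>v. (B ^^ n) f v + (B ^^ n) g v)"
  by (induction n) (simp_all add: B_add)

lemma B_pow_sum: "(B ^^ n) (\<lambda>u. \<Sum>i\<in>I. a i * g i u) = (\<lambda>u. \<Sum>i\<in>I. a i * (B ^^ n) (g i) u)"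
  by (induction n) (simp_all add: B_sum)

lemma continuous_B: "continuous_map mtopology mtopology B"
proof -
  obtain K where K: "\<And>f. f \<in> \<C> \<Longrightarrow> nrm (B f) \<le> K * nrm f"
    using bounded unfolding bounded_operator_Ces_def by blast
  define L where "L = \<bar>K\<bar> + 1"
  have L: "0 < L" "\<And>f. f \<in> \<C> \<Longrightarrow> nrm (B f) \<le> L * nrm f"
  proof -
    show "0 < L" by (simp add: L_def)
    fix f assume "f \<in> \<C>"
    then have "nrm (B f) \<le> K * nrm f" by (rule K)
    also have "\<dots> \<le> L * nrm f" by (intro mult_right_mono) (auto simp: L_def)
    finally show "nrm (B f) \<le> L * nrm f" .
  qed
  show ?thesis
    unfolding metric_continuous_map[OF Metric_space_axioms]
  proof (intro conjI ballI allI impI)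
    fix f and \<epsilon> :: real assume f: "f \<in> \<C>" and \<epsilon>: "\<epsilon> > 0"
    have "nrm (\<lambda>v. B f v - B g v) < \<epsilon>" if "g \<in> \<C>" "nrm (\<lambda>v. f v - g v) < \<epsilon> / L" for g
    proof -
      have "nrm (\<lambda>v. B f v - B g v) \<le> L * nrm (\<lambda>v. f v - g v)"
        using L(2)[OF Ces_diff[OF f that(1)]] by (simp add: B_diff)
      also have "\<dots> < \<epsilon>"
        using that(2) L(1) by (simp add: field_simps)
      finally show ?thesis .
    qed
    then show "\<exists>\<delta>>0. \<forall>g. g \<in> \<C> \<and> nrm (\<lambda>v. f v - g v) < \<delta> \<longrightarrow> nrm (\<lambda>v. B f v - B g v) < \<epsilon>"
      using L(1) \<epsilon> by (intro exI[of _ "\<epsilon> / L"]) auto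
  qed (auto simp: B_in_Ces)
qed

text \<open>Each step brings the support one level closer to the root, where it disappears.\<close>

lemma B_pow_vanish:
  assumes "\<And>u. n \<le> depth E rt u \<Longrightarrow> f u = 0"
  shows "(B ^^ n) f = (\<lambda>v. 0)"
  using assms
proof (induction n arbitrary: f)
  case (Suc n)
  have "B f u = 0" if "n \<le> depth E rt u" for u
    unfolding backward_shift_def
    using that Suc.prems by (intro sum.neutral ballI) (simp add: depth_Chi)
  from Suc.IH[OF this] show ?case by (simp add: funpow_Suc_right del: funpow.simps)
qed auto

definition fixed_vector :: "'v \<Rightarrow> ('v \<Rightarrow> complex) \<Rightarrow> bool" where
  "fixed_vector v f \<longleftrightarrow> f \<in> \<C> \<and> (\<forall>u. u \<notin> descendants E v \<longrightarrow> f u = 0) \<and> f v = 1 \<and>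
     (\<forall>u\<in>descendants E v. B f u = f u)"

definition slice :: "(nat \<Rightarrow> bool) \<Rightarrow> ('v \<Rightarrow> complex) \<Rightarrow> 'v \<Rightarrow> complex" where
  "slice \<phi> f v = (if \<phi> (depth E rt v) then f v else 0)"

text \<open>
  The shift lowers the depth by one, so that it maps the part of a fixed vector on one level to
  the part on the preceding level. The vector is fixed on its subtree only; the single vertex where
  this could be felt is the parent of \<open>v\<close>, which is not reached as long as the level of \<open>v\<close>
  itself has been left out.
\<close>

lemma B_slice_fixed_vector:
  assumes f: "fixed_vector v f" and \<phi>: "\<not> \<phi> (depth E rt v)"
  shows "B (slice \<phi> f) = slice (\<lambda>m. \<phi> (Suc m)) f"
proof
  fix u
  have "B (slice \<phi> f) u = (\<Sum>w\<in>Chi E u. if \<phi> (Suc (depth E rt u)) then lam w * f w else 0)"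
    unfolding backward_shift_def by (intro sum.cong) (auto simp: slice_def depth_Chi)
  then have B: "B (slice \<phi> f) u = (if \<phi> (Suc (depth E rt u)) then B f u else 0)"
    by (simp add: backward_shift_def)
  show "B (slice \<phi> f) u = slice (\<lambda>m. \<phi> (Suc m)) f u"
  proof (cases "u \<in> descendants E v")
    case True
    then show ?thesis using f B by (simp add: fixed_vector_def slice_def)
  next
    case False
    have "B f u = 0" if "\<phi> (Suc (depth E rt u))"
    proof -
      have "w \<notin> descendants E v" if w: "w \<in> Chi E u" for w
      proof
        assume "w \<in> descendants E v"
        with False w have "w = v" using descendants_parent by blast
        with w \<phi> \<open>\<phi> (Suc (depth E rt u))\<close> show False by (simp add: depth_Chi)
      qed
      then show ?thesis
        unfolding backward_shift_def using f
        by (intro sum.neutral) (simp add: fixed_vector_def)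
    qed
    then show ?thesis using False f B by (simp add: fixed_vector_def slice_def)
  qed
qed

lemma B_pow_slice_fixed_vector:
  assumes "fixed_vector v f" and "\<And>j. j < n \<Longrightarrow> \<not> \<phi> (depth E rt v + j)"
  shows "(B ^^ n) (slice \<phi> f) = slice (\<lambda>m. \<phi> (m + n)) f"
  using assms(2)
proof (induction n arbitrary: \<phi>)
  case (Suc n)
  have "(B ^^ Suc n) (slice \<phi> f) = (B ^^ n) (slice (\<lambda>m. \<phi> (Suc m)) f)"
    using B_slice_fixed_vector[OF assms(1), of \<phi>] Suc.prems[of 0]
    by (simp add: funpow_Suc_right del: funpow.simps)
  also have "\<dots> = slice (\<lambda>m. \<phi> (Suc (m + n))) f"
    using Suc.prems[of "Suc _"] by (intro Suc.IH) simp
  finally show ?case by simp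
qed simp

lemma slice_cong_fixed_vector:
  assumes "fixed_vector v f" "\<And>m. depth E rt v \<le> m \<Longrightarrow> \<phi> m = \<psi> m"
  shows "slice \<phi> f = slice \<psi> f"
  using assms by (fastforce simp: slice_def fixed_vector_def in_descendants_iff)

lemma slice_fixed_vector_top:
  assumes "fixed_vector v f"
  shows "slice (\<lambda>m. m = depth E rt v) f = unit_vector v"
  using assms by (fastforce simp: slice_def fixed_vector_def in_descendants_iff)

text \<open>
  Periodic points and preimages are finite combinations of slices; the uniformity in the choice of
  the slices makes one estimate serve both.
\<close>

lemma slice_combination_small:
  fixes f :: "'v \<Rightarrow> 'v \<Rightarrow> complex"
  assumes "finite F" "\<And>v. v \<in> F \<Longrightarrow> f v \<in> \<C>" "\<epsilon> > 0"
  shows "\<forall>\<^sub>F N in sequentially. \<forall>\<phi>. (\<forall>v\<in>F. \<forall>m. \<phi> v m \<longrightarrow> N \<le> m) \<longrightarrow>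
    (\<lambda>u. \<Sum>v\<in>F. a v * slice (\<phi> v) (f v) u) \<in> \<C> \<and>
    nrm (\<lambda>u. \<Sum>v\<in>F. a v * slice (\<phi> v) (f v) u) < \<epsilon>"
proof -
  \<comment> \<open>The summand 1 keeps the divisor positive if all coefficients vanish.\<close>
  define S where "S = 1 + (\<Sum>v\<in>F. cmod (a v))"
  have S: "0 < S" by (simp add: S_def add_pos_nonneg sum_nonneg)
  have "\<forall>v\<in>F. \<forall>\<^sub>F N in sequentially. \<forall>\<phi>. (\<forall>m. \<phi> m \<longrightarrow> N \<le> m) \<longrightarrow>
      slice \<phi> (f v) \<in> \<C> \<and> nrm (slice \<phi> (f v)) < \<epsilon> / S"
  proof
    fix v assume v: "v \<in> F"
    obtain m0 where m0: "\<And>m g. m \<ge> m0 \<Longrightarrow>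
        (\<And>u. cmod (g u) \<le> (if m \<le> depth E rt u then cmod (f v u) else 0)) \<Longrightarrow>
        g \<in> \<C> \<and> nrm g < \<epsilon> / S"
      using Ces_tail_small[OF assms(2)[OF v], of "\<epsilon> / S"] assms(3) S by auto
    show "\<forall>\<^sub>F N in sequentially. \<forall>\<phi>. (\<forall>m. \<phi> m \<longrightarrow> N \<le> m) \<longrightarrow>
      slice \<phi> (f v) \<in> \<C> \<and> nrm (slice \<phi> (f v)) < \<epsilon> / S"
      unfolding eventually_sequentially
    proof (intro exI[of _ m0] allI impI)
      fix N and \<phi> :: "nat \<Rightarrow> bool" assume N: "m0 \<le> N" "\<forall>m. \<phi> m \<longrightarrow> N \<le> m"
      show "slice \<phi> (f v) \<in> \<C> \<and> nrm (slice \<phi> (f v)) < \<epsilon> / S"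
        by (rule m0[OF N(1)]) (use N(2) in \<open>auto simp: slice_def\<close>)
    qed
  qed
  then have "\<forall>\<^sub>F N in sequentially. \<forall>v\<in>F. \<forall>\<phi>. (\<forall>m. \<phi> m \<longrightarrow> N \<le> m) \<longrightarrow>
      slice \<phi> (f v) \<in> \<C> \<and> nrm (slice \<phi> (f v)) < \<epsilon> / S"
    by (intro eventually_ball_finite assms(1))
  then show ?thesis
  proof (rule eventually_mono, intro allI impI)
    fix N and \<phi> :: "'v \<Rightarrow> nat \<Rightarrow> bool"
    assume A: "\<forall>v\<in>F. \<forall>\<phi>. (\<forall>m. \<phi> m \<longrightarrow> N \<le> m) \<longrightarrow>
      slice \<phi> (f v) \<in> \<C> \<and> nrm (slice \<phi> (f v)) < \<epsilon> / S"
      and \<phi>: "\<forall>v\<in>F. \<forall>m. \<phi> v m \<longrightarrow> N \<le> m"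
    have s: "slice (\<phi> v) (f v) \<in> \<C>" "nrm (slice (\<phi> v) (f v)) < \<epsilon> / S" if "v \<in> F" for v
      using A \<phi> that by blast+
    have "nrm (\<lambda>u. \<Sum>v\<in>F. a v * slice (\<phi> v) (f v) u)
        \<le> (\<Sum>v\<in>F. nrm (\<lambda>u. a v * slice (\<phi> v) (f v) u))"
      by (intro Ces_sum Ces_scale assms s)
    also have "\<dots> = (\<Sum>v\<in>F. cmod (a v) * nrm (slice (\<phi> v) (f v)))"
      by (intro sum.cong refl Ces_scale s)
    also have "\<dots> \<le> (\<Sum>v\<in>F. cmod (a v) * (\<epsilon> / S))"
      using s(2) by (intro sum_mono mult_left_mono) (auto intro: less_imp_le)
    also have "\<dots> = (S - 1) * (\<epsilon> / S)"
      by (subst sum_distrib_right[symmetric]) (simp add: S_def)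
    also have "\<dots> < \<epsilon>"
      using S assms(3) by (simp add: field_simps)
    finally have "nrm (\<lambda>u. \<Sum>v\<in>F. a v * slice (\<phi> v) (f v) u) < \<epsilon>" .
    moreover have "(\<lambda>u. \<Sum>v\<in>F. a v * slice (\<phi> v) (f v) u) \<in> \<C>"
      by (intro Ces_sum Ces_scale assms s)
    ultimately show "(\<lambda>u. \<Sum>v\<in>F. a v * slice (\<phi> v) (f v) u) \<in> \<C> \<and>
        nrm (\<lambda>u. \<Sum>v\<in>F. a v * slice (\<phi> v) (f v) u) < \<epsilon>" by blast
  qed
qed

section \<open>Fixed vectors produce periodic points and mixing\<close>

text \<open>
  The levels \<open>|v|, |v| + N, |v| + 2N, \<dots>\<close> of a fixed vector at \<open>v\<close> form an \<open>N\<close>-periodic point,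
  provided \<open>N > |v|\<close>, so that \<open>N\<close> steps push the unit vector at \<open>v\<close> beyond the root. It
  differs from the unit vector at \<open>v\<close> only from level \<open>N\<close> on.
\<close>

lemma periodic_points_dense:
  assumes "\<And>v. fixed_vector v (F v)"
  shows "dense_in X (periodic_points X B)"
  unfolding dense_in_iff
proof (intro conjI ballI allI impI)
  show "periodic_points X B \<subseteq> \<C>"
    by (auto simp: periodic_points_def ces_topology_eq)
next
  fix f and \<epsilon> :: real assume f: "f \<in> \<C>" and \<epsilon>: "\<epsilon> > 0"
  obtain g where "finite_depth g" and g: "g \<in> \<C>" "nrm (\<lambda>v. f v - g v) < \<epsilon> / 2"
    using finite_depth_dense[OF f, of "\<epsilon> / 2"] \<epsilon> by auto
  then obtain M where M: "\<And>v. M \<le> depth E rt v \<Longrightarrow> g v = 0"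
    by (auto simp: finite_depth_def)
  define A where "A = {v. depth E rt v < M}"
  have A: "finite A" unfolding A_def by (rule finite_depth_less)
  \<comment> \<open>The levels \<open>|v| + kN\<close> with \<open>k \<ge> 1\<close>; the one with \<open>k = 0\<close> contributes \<open>g\<close> itself.\<close>
  define \<phi> where "\<phi> N v m \<longleftrightarrow> depth E rt v < m \<and> (m - depth E rt v) mod N = 0" for N v m
  have "\<forall>\<^sub>F N in sequentially. \<forall>\<phi>. (\<forall>v\<in>A. \<forall>m. \<phi> v m \<longrightarrow> N \<le> m) \<longrightarrow>
    (\<lambda>u. \<Sum>v\<in>A. g v * slice (\<phi> v) (F v) u) \<in> \<C> \<and>
    nrm (\<lambda>u. \<Sum>v\<in>A. g v * slice (\<phi> v) (F v) u) < \<epsilon> / 2"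
    using assms \<epsilon> by (intro slice_combination_small A) (auto simp: fixed_vector_def)
  moreover have "\<forall>\<^sub>F N in sequentially. M < N"
    by (rule eventually_gt_at_top)
  ultimately have "\<forall>\<^sub>F N in sequentially. M < N \<and>
    (\<lambda>u. \<Sum>v\<in>A. g v * slice (\<phi> N v) (F v) u) \<in> \<C> \<and>
    nrm (\<lambda>u. \<Sum>v\<in>A. g v * slice (\<phi> N v) (F v) u) < \<epsilon> / 2"
  proof eventually_elim
    case (elim N)
    have "N \<le> m" if "\<phi> N v m" for v m
    proof -
      have "N dvd m - depth E rt v" "0 < m - depth E rt v"
        using that by (auto simp: \<phi>_def)
      then show ?thesis by (meson dvd_imp_le diff_le_self order_trans)
    qed
    then show ?case using elim by blast
  qed
  then obtain N where N: "M < N" "(\<lambda>u. \<Sum>v\<in>A. g v * slice (\<phi> N v) (F v) u) \<in> \<C>"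
    "nrm (\<lambda>u. \<Sum>v\<in>A. g v * slice (\<phi> N v) (F v) u) < \<epsilon> / 2"
    by (auto simp: eventually_sequentially)
  define k where "k u = (\<Sum>v\<in>A. g v * slice (\<phi> N v) (F v) u)" for u
  have k: "k \<in> \<C>" "nrm k < \<epsilon> / 2"
    using N by (simp_all add: k_def[abs_def])
  define h where "h u = g u + k u" for u
  have h_sum: "h = (\<lambda>u. \<Sum>v\<in>A. g v * (unit_vector v u + slice (\<phi> N v) (F v) u))"
  proof
    fix u
    have "(\<Sum>v\<in>A. g v * unit_vector v u) = g u"
      unfolding A_def by (rule expand_unit_vectors[OF M, THEN fun_cong, symmetric])
    then show "h u = (\<Sum>v\<in>A. g v * (unit_vector v u + slice (\<phi> N v) (F v) u))"
      unfolding h_def k_def distrib_left sum.distrib by simp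
  qed
  have step: "(B ^^ N) (\<lambda>u. unit_vector v u + slice (\<phi> N v) (F v) u) =
      (\<lambda>u. unit_vector v u + slice (\<phi> N v) (F v) u)" if v: "v \<in> A" for v
  proof -
    have "(B ^^ N) (unit_vector v) = (\<lambda>u. 0)"
      using v N(1) by (intro B_pow_vanish) (auto simp: A_def)
    moreover have "(B ^^ N) (slice (\<phi> N v) (F v)) = slice (\<lambda>m. \<phi> N v (m + N)) (F v)"
      by (rule B_pow_slice_fixed_vector[OF assms]) (auto simp: \<phi>_def)
    moreover have "slice (\<lambda>m. \<phi> N v (m + N)) (F v) =
        slice (\<lambda>m. m = depth E rt v \<or> \<phi> N v m) (F v)"
    proof (rule slice_cong_fixed_vector[OF assms])
      fix m assume "depth E rt v \<le> m"
      then obtain i where "m = depth E rt v + i" by (auto simp: le_iff_add)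
      then show "\<phi> N v (m + N) = (m = depth E rt v \<or> \<phi> N v m)"
        using N(1) by (cases "i = 0") (simp_all add: \<phi>_def add.assoc)
    qed
    moreover have "slice (\<lambda>m. m = depth E rt v \<or> \<phi> N v m) (F v) =
        (\<lambda>u. slice (\<lambda>m. m = depth E rt v) (F v) u + slice (\<phi> N v) (F v) u)"
      by (auto simp: slice_def \<phi>_def)
    ultimately show ?thesis
      by (simp add: B_pow_add slice_fixed_vector_top[OF assms])
  qed
  have "(B ^^ N) h = h"
    unfolding h_sum B_pow_sum by (simp add: step)
  moreover have hC: "h \<in> \<C>"
    unfolding h_def[abs_def] by (intro Ces_add g k)
  ultimately have "h \<in> periodic_points X B"
    using N(1) by (auto simp: periodic_points_def ces_topology_eq intro!: exI[of _ N])
  moreover have "nrm (\<lambda>v. f v - h v) < \<epsilon>"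
  proof -
    have "nrm (\<lambda>v. g v - h v) = nrm k"
      by (subst ces_norm_diff_commute) (simp add: h_def)
    then show ?thesis
      using ces_norm_diff_triangle[OF f g(1) hC] g(2) k(2) by linarith
  qed
  ultimately show "\<exists>h\<in>periodic_points X B. nrm (\<lambda>v. f v - h v) < \<epsilon>" by blast
qed

text \<open>
  The level \<open>|v| + n\<close> of a fixed vector at \<open>v\<close> is an \<open>n\<close>-th preimage of the unit vector at
  \<open>v\<close>, and it tends to zero. Adding such small preimages of a target to a vector of finite
  depth, which is eventually annihilated, steers it to the target after \<open>n\<close> steps, for every
  large \<open>n\<close>.
\<close>

lemma fixed_vectors_imp_mixing:
  assumes "\<And>v. fixed_vector v (F v)"
  shows "topologically_mixing X B"
  unfolding topologically_mixing_def ces_topology_eq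
proof (intro allI impI)
  fix U W assume U: "openin mtopology U" "U \<noteq> {}" and W: "openin mtopology W" "W \<noteq> {}"
  from U obtain x0 r where x0: "x0 \<in> \<C>" and r: "r > 0" "mball x0 r \<subseteq> U"
    unfolding openin_mtopology by blast
  from W obtain y0 s where y0: "y0 \<in> \<C>" and s: "s > 0" "mball y0 s \<subseteq> W"
    unfolding openin_mtopology by blast
  obtain x where "finite_depth x" and x: "x \<in> \<C>" "nrm (\<lambda>v. x0 v - x v) < r / 2"
    using finite_depth_dense[OF x0, of "r / 2"] r by auto
  then obtain M where M: "\<And>v. M \<le> depth E rt v \<Longrightarrow> x v = 0"
    by (auto simp: finite_depth_def)
  obtain y where "finite_depth y" and y: "y \<in> \<C>" "nrm (\<lambda>v. y0 v - y v) < s"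
    using finite_depth_dense[OF y0, of s] s by auto
  then obtain M' where M': "\<And>v. M' \<le> depth E rt v \<Longrightarrow> y v = 0"
    by (auto simp: finite_depth_def)
  define A where "A = {v. depth E rt v < M'}"
  have A: "finite A" unfolding A_def by (rule finite_depth_less)
  have "\<forall>\<^sub>F N in sequentially. \<forall>\<phi>. (\<forall>v\<in>A. \<forall>m. \<phi> v m \<longrightarrow> N \<le> m) \<longrightarrow>
    (\<lambda>u. \<Sum>v\<in>A. y v * slice (\<phi> v) (F v) u) \<in> \<C> \<and>
    nrm (\<lambda>u. \<Sum>v\<in>A. y v * slice (\<phi> v) (F v) u) < r / 2"
    using assms r by (intro slice_combination_small A) (auto simp: fixed_vector_def)
  then obtain n0 where n0: "\<forall>n\<ge>n0. \<forall>\<phi>. (\<forall>v\<in>A. \<forall>m. \<phi> v m \<longrightarrow> n \<le> m) \<longrightarrow>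
    (\<lambda>u. \<Sum>v\<in>A. y v * slice (\<phi> v) (F v) u) \<in> \<C> \<and>
    nrm (\<lambda>u. \<Sum>v\<in>A. y v * slice (\<phi> v) (F v) u) < r / 2"
    unfolding eventually_sequentially ..
  have "(B ^^ n) ` U \<inter> W \<noteq> {}" if n: "n \<ge> max M n0" for n
  proof -
    define k where "k u = (\<Sum>v\<in>A. y v * slice (\<lambda>m. m = depth E rt v + n) (F v) u)" for u
    have k: "k \<in> \<C>" "nrm k < r / 2"
      using n0[rule_format, of n "\<lambda>v m. m = depth E rt v + n"] n by (simp_all add: k_def[abs_def])
    define z where "z u = x u + k u" for u
    have zC: "z \<in> \<C>" unfolding z_def[abs_def] by (intro Ces_add x k)
    have "nrm (\<lambda>v. x v - z v) = nrm k"
      by (subst ces_norm_diff_commute) (simp add: z_def)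
    then have "nrm (\<lambda>v. x0 v - z v) < r"
      using ces_norm_diff_triangle[OF x0 x(1) zC] x(2) k(2) by linarith
    then have zU: "z \<in> U" using r(2) x0 zC by auto
    have "(B ^^ n) (slice (\<lambda>m. m = depth E rt v + n) (F v)) = unit_vector v" for v
      using B_pow_slice_fixed_vector[OF assms, of n "\<lambda>m. m = depth E rt v + n" v]
        slice_fixed_vector_top[OF assms] by simp
    then have "(B ^^ n) k = (\<lambda>u. \<Sum>v\<in>A. y v * unit_vector v u)"
      unfolding k_def[abs_def] B_pow_sum by simp
    also have "\<dots> = y"
      unfolding A_def by (rule expand_unit_vectors[OF M', symmetric])
    finally have "(B ^^ n) k = y" .
    moreover have "(B ^^ n) x = (\<lambda>u. 0)"
      using M n by (intro B_pow_vanish) simp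
    ultimately have "(B ^^ n) z = y"
      by (simp add: z_def[abs_def] B_pow_add)
    moreover have "y \<in> W" using s(2) y0 y by auto
    ultimately show ?thesis using zU by blast
  qed
  then show "\<exists>n0. \<forall>n\<ge>n0. (B ^^ n) ` U \<inter> W \<noteq> {}" by blast
qed

lemma mixing_imp_hypercyclic_shift:
  assumes "topologically_mixing X B"
  shows "hypercyclic X B"
proof -
  obtain D where D: "countable D" "D \<subseteq> \<C>"
    "\<And>f \<epsilon>. f \<in> \<C> \<Longrightarrow> \<epsilon> > 0 \<Longrightarrow> \<exists>g\<in>D. nrm (\<lambda>v. f v - g v) < \<epsilon>"
    using Ces_separable by blast
  have "\<C> \<noteq> {}" using zero_in_Ces by blast
  from mixing_imp_hypercyclic[OF Ces_mcomplete this D continuous_B] assms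
  show ?thesis by (simp add: ces_topology_eq)
qed

section \<open>Flows\<close>

text \<open>
  Division by the path weights turns the flow equation into the fixed vector equation, and the
  series attached to a flow into the \<open>p\<close>-th power of a Cesaro norm.
\<close>

definition flow_vector :: "'v \<Rightarrow> ('v \<Rightarrow> real) \<Rightarrow> 'v \<Rightarrow> complex" where
  "flow_vector v \<theta> u = (if u \<in> descendants E v then of_real (\<theta> u) / path_weight E lam v u else 0)"

definition flow_summable :: "'v \<Rightarrow> ('v \<Rightarrow> real) \<Rightarrow> bool" where
  "flow_summable v \<theta> \<longleftrightarrow>
    (\<lambda>N. (1 / (real N + 1) *
            (\<Sum>s=depth E rt v..N. 1 / real (level_card E rt s) *
               (\<Sum>u\<in>Chi_pow E (s - depth E rt v) v. \<theta> u / cmod (path_weight E lam v u)))) powr p)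
         summable_on {depth E rt v..}"

lemma flow_summable_iff:
  assumes "\<And>u. u \<in> descendants E v \<Longrightarrow> 0 \<le> \<theta> u"
  shows "flow_summable v \<theta> \<longleftrightarrow> flow_vector v \<theta> \<in> \<C>"
proof -
  define T where "T N = (1 / (real N + 1) *
            (\<Sum>s=depth E rt v..N. 1 / real (level_card E rt s) *
               (\<Sum>u\<in>Chi_pow E (s - depth E rt v) v. \<theta> u / cmod (path_weight E lam v u)))) powr p"
    for N
  let ?A = "\<lambda>s. level_avg E rt s (flow_vector v \<theta>)"
  have above: "?A s = 0" if "s < depth E rt v" for s
  proof -
    have "(\<Sum>u\<in>level E rt s. cmod (flow_vector v \<theta> u)) = 0"
      using that by (intro sum.neutral ballI) (simp add: flow_vector_def in_descendants_iff)
    then show ?thesis by (simp add: level_avg_def)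
  qed
  have below: "?A s = 1 / real (level_card E rt s) *
      (\<Sum>u\<in>Chi_pow E (s - depth E rt v) v. \<theta> u / cmod (path_weight E lam v u))"
    if s: "depth E rt v \<le> s" for s
  proof -
    have sub: "u \<in> descendants E v" if "u \<in> Chi_pow E n v" for u n
      using that by (auto simp: descendants_def)
    have "(\<Sum>u\<in>level E rt s. cmod (flow_vector v \<theta> u)) =
        (\<Sum>u\<in>Chi_pow E (s - depth E rt v) v. cmod (flow_vector v \<theta> u))"
      using s by (intro sum.mono_neutral_right)
        (auto simp: depth_Chi_pow flow_vector_def in_descendants_iff)
    also have "\<dots> = (\<Sum>u\<in>Chi_pow E (s - depth E rt v) v. \<theta> u / cmod (path_weight E lam v u))"
      by (intro sum.cong refl) (auto simp: flow_vector_def norm_divide assms dest!: sub)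
    finally show ?thesis by (simp add: level_avg_def)
  qed
  have sums: "(\<Sum>s=0..N. ?A s) = (\<Sum>s=depth E rt v..N. 1 / real (level_card E rt s) *
               (\<Sum>u\<in>Chi_pow E (s - depth E rt v) v. \<theta> u / cmod (path_weight E lam v u)))" for N
  proof -
    have "(\<Sum>s=0..N. ?A s) = (\<Sum>s=depth E rt v..N. ?A s)"
      by (intro sum.mono_neutral_right) (auto intro: above)
    also have "\<dots> = (\<Sum>s=depth E rt v..N. 1 / real (level_card E rt s) *
               (\<Sum>u\<in>Chi_pow E (s - depth E rt v) v. \<theta> u / cmod (path_weight E lam v u)))"
      by (intro sum.cong refl below) simp
    finally show ?thesis .
  qed
  have term_eq: "ces_term E rt p (flow_vector v \<theta>) = T"
    by (simp add: fun_eq_iff ces_term_def sums T_def)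
  have "T summable_on {depth E rt v..} \<longleftrightarrow> T summable_on UNIV"
    by (rule summable_on_cong_neutral) (auto simp: T_def)
  also have "\<dots> \<longleftrightarrow> summable T"
    by (rule summable_on_UNIV_nonneg_real_iff) (simp add: T_def)
  finally show ?thesis
    unfolding flow_summable_def Ces_def mem_Collect_eq term_eq T_def[abs_def] .
qed

text \<open>
  A nonnegative function that is dominated at each vertex by its own weighted sum over the children
  (a "superflow" after multiplication with the path weights) contains a flow: descending from
  \<open>v\<close>, the mass at a vertex is distributed among its children in proportion to what the
  function offers there, and the domination ensures that no more is demanded than is offered.
  The share that a vertex receives from its parent is itself a weight family, and the flow is the
  product of the shares along the path.
\<close>

lemma superflow_contains_unit_flow:
  assumes nz: "\<And>u. u \<noteq> rt \<Longrightarrow> lam u \<noteq> 0"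
    and H: "\<And>u. 0 \<le> H u" "0 < H v"
    and super: "\<And>u. u \<in> descendants E v \<Longrightarrow> H u \<le> (\<Sum>w\<in>Chi E u. cmod (lam w) * H w)"
  obtains \<theta> where "unit_flow_on E v \<theta>"
    "\<And>u. u \<in> descendants E v \<Longrightarrow> \<theta> u / cmod (path_weight E lam v u) \<le> H u / H v"
proof -
  define T where "T u = (\<Sum>w\<in>Chi E u. cmod (lam w) * H w)" for u
  define share where "share w = cmod (lam w) * H w / T (THE u. w \<in> Chi E u)" for w
  have share: "share w = cmod (lam w) * H w / T u" if "w \<in> Chi E u" for u w
  proof -
    have "(THE u. w \<in> Chi E u) = u" using that parent_unique by blast
    then show ?thesis by (simp add: share_def)
  qed
  have T_nonneg: "0 \<le> T u" for u
    unfolding T_def by (intro sum_nonneg) (simp add: H)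
  have share_nonneg: "0 \<le> share w" for w
    by (simp add: share_def H T_nonneg)
  define \<theta> where "\<theta> u = cmod (path_weight E (\<lambda>w. of_real (share w)) v u)" for u
  have \<theta>_nonneg: "0 \<le> \<theta> u" for u by (simp add: \<theta>_def)
  have \<theta>_Chi: "\<theta> w = \<theta> u * share w" if "u \<in> descendants E v" "w \<in> Chi E u" for u w
    using that share_nonneg by (simp add: \<theta>_def path_weight_Chi norm_mult)
  have \<theta>_v: "\<theta> v = 1" by (simp add: \<theta>_def)
  have bound: "\<theta> u * H v \<le> cmod (path_weight E lam v u) * H u" if "u \<in> descendants E v" for u
    using that
  proof (induction u rule: descendants_induct)
    case self
    then show ?case by (simp add: \<theta>_v)
  next
    case (child u w)
    have "\<theta> u * H v \<le> cmod (path_weight E lam v u) * H u"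
      by (rule child.IH)
    also have "\<dots> \<le> cmod (path_weight E lam v u) * T u"
      unfolding T_def using child.hyps by (intro mult_left_mono super) auto
    finally have "\<theta> u * H v \<le> cmod (path_weight E lam v u) * T u" .
    then have "\<theta> u * H v * share w \<le> cmod (path_weight E lam v u) * T u * share w"
      by (intro mult_right_mono share_nonneg)
    also have "\<dots> \<le> cmod (path_weight E lam v u) * (cmod (lam w) * H w)"
      using child T_nonneg[of u] H by (auto simp: share)
    finally show ?case
      using child by (simp add: \<theta>_Chi path_weight_Chi norm_mult ac_simps)
  qed
  have flow: "\<theta> u = (\<Sum>w\<in>Chi E u. \<theta> w)" if u: "u \<in> descendants E v" for u
  proof (cases "T u = 0")
    case True
    \<comment> \<open>Nothing is offered by the children; then \<open>\<theta> u = 0\<close> by the bound.\<close>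
    then have "H u = 0" using super[OF u] H(1)[of u] by (simp add: T_def)
    then have "\<theta> u * H v \<le> 0" using bound[OF u] by simp
    then have "\<theta> u = 0"
      using H(2) by (simp add: \<theta>_def mult_le_0_iff)
    then show ?thesis using u by (simp add: \<theta>_Chi)
  next
    case False
    have "(\<Sum>w\<in>Chi E u. \<theta> w) = (\<Sum>w\<in>Chi E u. \<theta> u / T u * (cmod (lam w) * H w))"
      using u by (intro sum.cong) (simp_all add: \<theta>_Chi share)
    also have "\<dots> = \<theta> u"
      using False by (subst sum_distrib_left[symmetric]) (simp add: T_def[symmetric])
    finally show ?thesis by simp
  qed
  have pw: "path_weight E lam v u \<noteq> 0" if "u \<in> descendants E v" for u
    by (rule path_weight_nonzero[OF that nz])
  show ?thesis
  proof (rule that[of \<theta>])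
    show "unit_flow_on E v \<theta>"
      unfolding unit_flow_on_def flow_on_def using flow \<theta>_nonneg \<theta>_v by blast
    show "\<theta> u / cmod (path_weight E lam v u) \<le> H u / H v" if "u \<in> descendants E v" for u
      using bound[OF that] pw[OF that] H by (simp add: field_simps)
  qed
qed

lemma superflow_imp_summable_flow:
  assumes nz: "\<And>u. u \<noteq> rt \<Longrightarrow> lam u \<noteq> 0"
    and H: "\<And>u. 0 \<le> H u" "0 < H v" "(\<lambda>u. of_real (H u)) \<in> \<C>"
    and super: "\<And>u. u \<in> descendants E v \<Longrightarrow> H u \<le> (\<Sum>w\<in>Chi E u. cmod (lam w) * H w)"
  shows "\<exists>\<theta>. unit_flow_on E v \<theta> \<and> flow_summable v \<theta>"
proof -
  obtain \<theta> where \<theta>: "unit_flow_on E v \<theta>"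
    "\<And>u. u \<in> descendants E v \<Longrightarrow> \<theta> u / cmod (path_weight E lam v u) \<le> H u / H v"
    using superflow_contains_unit_flow[OF nz H(1,2) super] by blast
  have nonneg: "0 \<le> \<theta> u" if "u \<in> descendants E v" for u
    using \<theta>(1) that unfolding unit_flow_on_def flow_on_def by blast
  have "flow_vector v \<theta> \<in> \<C>"
  proof (rule Ces_mono[OF Ces_scale(1)[OF H(3), of "of_real (1 / H v)"]])
    show "cmod (flow_vector v \<theta> u) \<le> cmod (of_real (1 / H v) * of_real (H u))" for u
      using \<theta>(2)[of u] H(1)[of u] H(2) nonneg[of u]
      by (auto simp: flow_vector_def norm_mult norm_divide)
  qed
  with \<theta>(1) nonneg show ?thesis
    using flow_summable_iff by blast
qed

text \<open>
  If \<open>B\<^sup>N g = g\<close>, then the sum of the \<open>|B\<^sup>j g|\<close> over \<open>j < N\<close> is dominated by its own weighted sum over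
  the children: by the triangle inequality each summand is dominated by that of its predecessor in
  the cyclic order. Absolute values are essential, as the sum of the \<open>B\<^sup>j g\<close>, although fixed by
  \<open>B\<close>, may vanish.
\<close>

lemma periodic_imp_summable_flow:
  assumes nz: "\<And>u. u \<noteq> rt \<Longrightarrow> lam u \<noteq> 0"
    and g: "g \<in> \<C>" "(B ^^ N) g = g" "1 \<le> N" "g v \<noteq> 0"
  shows "\<exists>\<theta>. unit_flow_on E v \<theta> \<and> flow_summable v \<theta>"
proof (rule superflow_imp_summable_flow[OF nz])
  define H where "H u = (\<Sum>j<N. cmod ((B ^^ j) g u))" for u
  show "0 \<le> H u" for u by (simp add: H_def sum_nonneg)
  have "cmod ((B ^^ 0) g v) \<le> H v"
    unfolding H_def by (rule member_le_sum) (use g in auto)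
  then have "cmod (g v) \<le> H v" by simp
  moreover have "0 < cmod (g v)" using g(4) by simp
  ultimately show "0 < H v" by linarith
  have "(\<lambda>u. of_real (cmod ((B ^^ j) g u))) \<in> \<C>" for j
    by (rule Ces_mono[OF B_pow_in_Ces[OF g(1), of j]]) simp
  then have "(\<lambda>u. \<Sum>j<N. of_real (cmod ((B ^^ j) g u))) \<in> \<C>"
    by (intro Ces_sum) auto
  then show "(\<lambda>u. of_real (H u)) \<in> \<C>" by (simp add: H_def)
  show "H u \<le> (\<Sum>w\<in>Chi E u. cmod (lam w) * H w)" for u
  proof -
    have "(\<Sum>j<N. cmod ((B ^^ j) g u)) + cmod ((B ^^ N) g u) =
        cmod ((B ^^ 0) g u) + (\<Sum>j<N. cmod ((B ^^ Suc j) g u))"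
      by (rule trans[OF sum.lessThan_Suc[symmetric] sum.lessThan_Suc_shift])
    then have "H u = (\<Sum>j<N. cmod ((B ^^ Suc j) g u))"
      using g(2) by (simp add: H_def)
    also have "\<dots> \<le> (\<Sum>j<N. \<Sum>w\<in>Chi E u. cmod (lam w) * cmod ((B ^^ j) g w))"
    proof (rule sum_mono)
      fix j
      have "cmod (B ((B ^^ j) g) u) \<le> (\<Sum>w\<in>Chi E u. cmod (lam w * (B ^^ j) g w))"
        unfolding backward_shift_def[of E lam "(B ^^ j) g"] by (rule norm_sum)
      then show "cmod ((B ^^ Suc j) g u) \<le> (\<Sum>w\<in>Chi E u. cmod (lam w) * cmod ((B ^^ j) g w))"
        by (simp add: norm_mult)
    qed
    also have "\<dots> = (\<Sum>w\<in>Chi E u. cmod (lam w) * H w)"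
      by (subst sum.swap) (simp add: H_def sum_distrib_left)
    finally show ?thesis .
  qed
qed

lemma fixed_vector_imp_summable_flow:
  assumes nz: "\<And>u. u \<noteq> rt \<Longrightarrow> lam u \<noteq> 0" and f: "fixed_vector v f"
  shows "\<exists>\<theta>. unit_flow_on E v \<theta> \<and> flow_summable v \<theta>"
proof (rule superflow_imp_summable_flow[OF nz])
  show "(\<lambda>u. of_real (cmod (f u))) \<in> \<C>"
    by (rule Ces_mono[of f]) (use f in \<open>auto simp: fixed_vector_def\<close>)
  show "0 < cmod (f v)" using f by (simp add: fixed_vector_def)
  show "0 \<le> cmod (f u)" for u by simp
  fix u assume "u \<in> descendants E v"
  then have "cmod (f u) = cmod (\<Sum>w\<in>Chi E u. lam w * f w)"
    using f by (simp add: fixed_vector_def backward_shift_def[of E lam f])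
  also have "\<dots> \<le> (\<Sum>w\<in>Chi E u. cmod (lam w) * cmod (f w))"
    using norm_sum[of "\<lambda>w. lam w * f w" "Chi E u"] by (simp add: norm_mult)
  finally show "cmod (f u) \<le> (\<Sum>w\<in>Chi E u. cmod (lam w) * cmod (f w))" .
qed

lemma fixed_vector_flow_vector:
  assumes nz: "\<And>u. u \<noteq> rt \<Longrightarrow> lam u \<noteq> 0"
    and \<theta>: "unit_flow_on E v \<theta>" "flow_summable v \<theta>"
  shows "fixed_vector v (flow_vector v \<theta>)"
  unfolding fixed_vector_def
proof (intro conjI ballI allI impI)
  have flow: "0 \<le> \<theta> u" "\<theta> u = (\<Sum>w\<in>Chi E u. \<theta> w)" if "u \<in> descendants E v" for u
    using \<theta>(1) that unfolding unit_flow_on_def flow_on_def by blast+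
  show "flow_vector v \<theta> \<in> \<C>"
    using \<theta>(2) flow(1) by (simp add: flow_summable_iff)
  show "flow_vector v \<theta> v = 1"
    using \<theta>(1) by (simp add: flow_vector_def unit_flow_on_def)
  show "flow_vector v \<theta> u = 0" if "u \<notin> descendants E v" for u
    using that by (simp add: flow_vector_def)
  show "B (flow_vector v \<theta>) u = flow_vector v \<theta> u" if u: "u \<in> descendants E v" for u
  proof -
    have "lam w * flow_vector v \<theta> w = of_real (\<theta> w) / path_weight E lam v u"
      if w: "w \<in> Chi E u" for w
    proof -
      have "lam w \<noteq> 0" using nz w root_not_child by metis
      then show ?thesis
        using descendants_Chi[OF u w] by (simp add: flow_vector_def path_weight_Chi[OF u w])
    qed
    then have "B (flow_vector v \<theta>) u = (\<Sum>w\<in>Chi E u. of_real (\<theta> w) / path_weight E lam v u)"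
      by (simp add: backward_shift_def)
    also have "\<dots> = of_real (\<theta> u) / path_weight E lam v u"
      by (simp add: flow(2)[OF u] sum_divide_distrib)
    also have "\<dots> = flow_vector v \<theta> u"
      using u by (simp add: flow_vector_def)
    finally show ?thesis .
  qed
qed

lemma dense_meets_nonzero:
  assumes "dense_in X A"
  shows "\<exists>g\<in>A. g v \<noteq> 0"
proof -
  have A: "A \<subseteq> \<C>" "\<And>f \<epsilon>. f \<in> \<C> \<Longrightarrow> \<epsilon> > 0 \<Longrightarrow> \<exists>g\<in>A. nrm (\<lambda>u. f u - g u) < \<epsilon>"
    using assms unfolding dense_in_iff by simp_all
  obtain g where g: "g \<in> A" "nrm (\<lambda>u. unit_vector v u - g u) < 1 / eval_const v"
    using A(2)[OF unit_vector_in_Ces[of v], of "1 / eval_const v"] eval_const_pos[of v] by auto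
  have "cmod (unit_vector v v - g v) \<le> eval_const v * nrm (\<lambda>u. unit_vector v u - g u)"
    using A(1) g(1) by (intro cmod_le_norm Ces_diff unit_vector_in_Ces) auto
  also have "\<dots> < 1"
    using g(2) eval_const_pos[of v] by (simp add: field_simps)
  finally have "cmod (unit_vector v v - g v) < 1" .
  then have "g v \<noteq> 0" by auto
  then show ?thesis using g(1) by blast
qed

end

theorem theorem3p13:
  fixes E :: "('v \<times> 'v) set" and rt :: 'v and p :: real and lam :: "'v \<Rightarrow> complex"
  assumes p: "1 < p"
    and tree: "rooted_directed_tree E rt"
    and leafless: "leafless E"
    and locally_finite: "locally_finite_tree E"
    and bounded: "bounded_operator_Ces E rt p (backward_shift E lam)"
    and nonzero: "\<And>u. u \<noteq> rt \<Longrightarrow> lam u \<noteq> 0"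
  defines "X \<equiv> ces_topology E rt p"
    and "B \<equiv> backward_shift E lam"
  defines "cond_i \<equiv> chaotic X B"
    and "cond_ii \<equiv> dense_in X (periodic_points X B)"
    and "cond_iii \<equiv>
      (\<forall>v. \<exists>f\<in>Ces E rt p. (\<forall>u. u \<notin> descendants E v \<longrightarrow> f u = 0) \<and> f v = 1 \<and>
         (\<forall>u\<in>descendants E v. B f u = f u))"
    and "cond_iv \<equiv>
      (\<forall>v. \<exists>\<theta>. unit_flow_on E v \<theta> \<and>
         (\<lambda>N. (1 / (real N + 1) *
            (\<Sum>s=depth E rt v..N. 1 / real (level_card E rt s) *
               (\<Sum>u\<in>Chi_pow E (s - depth E rt v) v. \<theta> u / cmod (path_weight E lam v u)))) powr p)
         summable_on {depth E rt v..})"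
  shows "(cond_i \<longleftrightarrow> cond_ii) \<and> (cond_ii \<longleftrightarrow> cond_iii) \<and> (cond_iii \<longleftrightarrow> cond_iv) \<and>
         (cond_i \<longrightarrow> topologically_mixing X B) \<and>
         (cond_ii \<longrightarrow> topologically_mixing X B) \<and>
         (cond_iii \<longrightarrow> topologically_mixing X B) \<and>
         (cond_iv \<longrightarrow> topologically_mixing X B)"
proof -
  interpret S: cesaro_shift E rt p lam
    by unfold_locales (fact tree leafless locally_finite p bounded)+
  have iii: "cond_iii \<longleftrightarrow> (\<forall>v. \<exists>f. S.fixed_vector v f)"
    unfolding cond_iii_def B_def S.fixed_vector_def by blast
  have iv: "cond_iv \<longleftrightarrow> (\<forall>v. \<exists>\<theta>. unit_flow_on E v \<theta> \<and> S.flow_summable v \<theta>)"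
    unfolding cond_iv_def S.flow_summable_def ..
  have i_ii: "cond_i \<Longrightarrow> cond_ii"
    by (simp add: cond_i_def cond_ii_def chaotic_def)
  have ii_iv: "cond_iv" if ii: "cond_ii"
    unfolding iv
  proof
    fix v
    obtain g where g: "g \<in> periodic_points X B" "g v \<noteq> 0"
      using S.dense_meets_nonzero[of _ v] ii unfolding cond_ii_def X_def by blast
    then obtain N where "g \<in> Ces E rt p" "(B ^^ N) g = g" "1 \<le> N"
      by (auto simp: periodic_points_def X_def S.ces_topology_eq)
    then show "\<exists>\<theta>. unit_flow_on E v \<theta> \<and> S.flow_summable v \<theta>"
      using S.periodic_imp_summable_flow[OF nonzero] g(2) unfolding B_def by blast
  qed
  have iii_iv: "cond_iii \<Longrightarrow> cond_iv"
    unfolding iii iv using S.fixed_vector_imp_summable_flow[OF nonzero] by blast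
  have iv_iii: "cond_iv \<Longrightarrow> cond_iii"
    unfolding iii iv using S.fixed_vector_flow_vector[OF nonzero] by blast
  have iii_rest: "cond_i \<and> topologically_mixing X B" if iii_holds: "cond_iii"
  proof -
    obtain F where F: "\<And>v. S.fixed_vector v (F v)"
      using iii_holds unfolding iii by metis
    show ?thesis
      unfolding cond_i_def chaotic_def X_def B_def
      using S.periodic_points_dense[OF F] S.fixed_vectors_imp_mixing[OF F]
        S.mixing_imp_hypercyclic_shift by blast
  qed
  show ?thesis
    using i_ii ii_iv iii_iv iv_iii iii_rest by blast
qed

end
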